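(* Let $p\ge 1$ be an integer and let $\boldsymbol{\beta}=(\beta_0,\ldots,\beta_{p-1})$ be a $p$-tuple of real numbers greater than $1$. For $\lambda$-almost all $x\in[0,1)$, the frequency of any digit $d$ occurring in the greedy $\boldsymbol{\beta}$-expansion of $x$ exists and is equal to $$\frac1p\sum_{i=0}^{p-1}\mu_{\boldsymbol{\beta},i}\Big(\big[\tfrac{d}{\beta_i},\tfrac{d+1}{\beta_i}\big)\cap[0,1)\Big).$$
   Context: Convention: for $n\in\mathbb{Z}$, $\beta_n=\beta_{n\bmod p}$. $\lambda$ is the Lebesgue measure. For a real $\beta>1$, $T_\beta\colon[0,1)\to[0,1)$, $x\mapsto \beta x-\lfloor\beta x\rfloor$. For $x\in[0,1)$, the greedy $\boldsymbol{\beta}$-expansion of $x$ is the infinite sequence $a_0a_1a_2\cdots$ of nonnegative integers with $a_n=\lfloor\beta_n\,(T_{\beta_{n-1}}\circ\cdots\circ T_{\beta_0}(x))\rfloor$ for all $n\ge0$. The frequency of a digit $d$ in $a_0a_1a_2\cdots$ is $\lim_{n\to\infty}\frac1n\#\{0\le k<n\colon a_k=d\}$, provided this limit exists. For each $i\in\{0,\ldots,p-1\}$, $\mu_{\boldsymbol{\beta},i}$ denotes the unique probability measure on the Borel $\sigma$-algebra of $[0,1)$ that is absolutely continuous with respect to $\lambda$ and invariant under $T_{\beta_{i-1}}\circ\cdots\circ T_{\beta_{i-p}}$ (existence and uniqueness hold). *)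

theory Defs
  imports "HOL-Analysis.Analysis" "HOL-Probability.Probability"
begin

definition beta_at :: "real list \<Rightarrow> int \<Rightarrow> real" where
  "beta_at \<beta> n = \<beta> ! nat (n mod int (length \<beta>))"

text \<open>The map is given on all reals; only its restriction to \<open>{0..<1}\<close>, which it sends to itself,
  is ever relevant.\<close>

definition beta_map :: "real \<Rightarrow> real \<Rightarrow> real" where
  "beta_map b x = b * x - of_int \<lfloor>b * x\<rfloor>"

text \<open>\<open>beta_comp \<beta> m n\<close> is the composition of the \<open>n\<close> maps with indices
  \<open>m, m + 1, \<dots>, m + n - 1\<close>, where the map with index \<open>m\<close> is applied first.\<close>

primrec beta_comp :: "real list \<Rightarrow> int \<Rightarrow> nat \<Rightarrow> real \<Rightarrow> real" where
  "beta_comp \<beta> m 0 = id"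
| "beta_comp \<beta> m (Suc n) = beta_map (beta_at \<beta> (m + int n)) \<circ> beta_comp \<beta> m n"

text \<open>For bases greater than 1 and \<open>x\<close> in \<open>{0..<1}\<close> the floor is nonnegative, so \<open>nat\<close> loses
  nothing.\<close>

definition greedy_digit :: "real list \<Rightarrow> real \<Rightarrow> nat \<Rightarrow> nat" where
  "greedy_digit \<beta> x n = nat \<lfloor>beta_at \<beta> (int n) * beta_comp \<beta> 0 n x\<rfloor>"

definition has_frequency :: "(nat \<Rightarrow> 'a) \<Rightarrow> 'a \<Rightarrow> real \<Rightarrow> bool" where
  "has_frequency a d f \<longleftrightarrow> (\<lambda>n. real (card {k. k < n \<and> a k = d}) / real n) \<longlonglongrightarrow> f"

abbreviation unit_lborel :: "real measure" where
  "unit_lborel \<equiv> restrict_space lborel {0..<1}"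

definition invariant_measure :: "'a measure \<Rightarrow> ('a \<Rightarrow> 'a) \<Rightarrow> bool" where
  "invariant_measure M T \<longleftrightarrow> T \<in> measurable M M \<and>
     (\<forall>A\<in>sets M. emeasure M (T -` A \<inter> space M) = emeasure M A)"

definition is_acip :: "real measure \<Rightarrow> (real \<Rightarrow> real) \<Rightarrow> bool" where
  "is_acip M T \<longleftrightarrow> sets M = sets (restrict_space borel {0..<1}) \<and> prob_space M \<and>
     absolutely_continuous unit_lborel M \<and> invariant_measure M T"

text \<open>The composition below applies the map with index \<open>i - p\<close> first and the one with index
  \<open>i - 1\<close> last, where \<open>p = length \<beta>\<close>.\<close>

definition beta_measure :: "real list \<Rightarrow> int \<Rightarrow> real measure" where
  "beta_measure \<beta> i =
     (THE M. is_acip M (beta_comp \<beta> (i - int (length \<beta>)) (length \<beta>)))"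

end

theory Submission
  imports Defs "HOL-Library.Discrete_Functions"
begin

text \<open>The transfer operators of the maps \<open>x \<mapsto> bx - \<lfloor>bx\<rfloor>\<close> preserve the cone of nonnegative
  decreasing functions on the unit interval. Since every base is at least some \<open>q > 1\<close>, a fixed number
  of them maps each function of this cone whose value at \<open>0\<close> is controlled by its integral to one
  bounded below by a multiple of that integral. Hence two such functions with the same integral are
  brought together at a geometric rate, uniformly in the starting index.

  This gives exponential decay of correlations for the visits of the orbit to initial segments, so
  their counts have variance \<open>O(n)\<close>, and a strong law of large numbers holds along the orbit of
  Lebesgue-almost every point. It also gives limit densities \<open>h\<^sub>i\<close> that depend only on \<open>i\<close> modulo the
  period and are invariant under the composition over one period. Integrating the strong law against
  any absolutely continuous invariant measure shows that its density is \<open>h\<^sub>i\<close>. The digit \<open>d\<close> occurs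
  when the orbit visits an interval, which is a difference of two initial segments, and averaging
  over the residues modulo the period gives the frequency.\<close>

section \<open>Bounded measurable functions supported in the unit interval\<close>

text \<open>Densities are genuine functions on the line rather than classes modulo null sets,
  because the contraction estimate and the limit densities below are pointwise. Vanishing outside
  \<open>{0..<1}\<close> lets all integrals be taken over \<open>lborel\<close>.\<close>

definition regular :: "(real \<Rightarrow> real) \<Rightarrow> bool" where
  "regular f \<longleftrightarrow> f \<in> borel_measurable borel \<and> (\<exists>B. \<forall>x. \<bar>f x\<bar> \<le> B) \<and> (\<forall>x. x \<notin> {0..<1} \<longrightarrow> f x = 0)"

lemma regularI:
  assumes "f \<in> borel_measurable borel" "\<And>x. \<bar>f x\<bar> \<le> B" "\<And>x. x \<notin> {0..<1} \<Longrightarrow> f x = 0"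
  shows "regular f"
  using assms unfolding regular_def by blast

lemma regular_measurable [measurable_dest]: "regular f \<Longrightarrow> f \<in> borel_measurable borel"
  by (simp add: regular_def)

lemma regular_outside: "regular f \<Longrightarrow> x \<notin> {0..<1} \<Longrightarrow> f x = 0"
  unfolding regular_def by blast

lemma regular_bounded: "regular f \<Longrightarrow> (\<And>B. 0 \<le> B \<Longrightarrow> (\<And>x. \<bar>f x\<bar> \<le> B) \<Longrightarrow> P) \<Longrightarrow> P"
  unfolding regular_def by (meson abs_ge_zero order_trans)

lemma integrable_unit_bounded:
  fixes f :: "real \<Rightarrow> real"
  assumes [measurable]: "f \<in> borel_measurable borel"
    and B: "\<And>x. \<bar>f x\<bar> \<le> B" and z: "\<And>x. x \<notin> {0..<1} \<Longrightarrow> f x = 0"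
  shows "integrable lborel f"
proof (rule Bochner_Integration.integrable_bound)
  show "integrable lborel (\<lambda>x. B * indicator {0..<1::real} x)"
    by simp
  show "AE x in lborel. norm (f x) \<le> norm (B * indicator {0..<1} x)"
    using B z by (auto intro!: AE_I2 simp: indicator_def intro: order_trans[OF _ abs_ge_self])
qed simp

lemma abs_integral_unit_le:
  fixes f :: "real \<Rightarrow> real"
  assumes B: "\<And>x. \<bar>f x\<bar> \<le> B" and z: "\<And>x. x \<notin> {0..<1} \<Longrightarrow> f x = 0"
  shows "\<bar>\<integral>x. f x \<partial>lborel\<bar> \<le> B"
proof -
  have B0: "0 \<le> B" using B[of 0] by linarith
  show ?thesis
  \<comment> \<open>If \<open>f\<close> is not integrable, its integral is 0 by convention and the
    claim reduces to \<open>B0\<close>.\<close>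
  proof (cases "integrable lborel f")
    case True
    have "\<bar>\<integral>x. f x \<partial>lborel\<bar> \<le> (\<integral>x. \<bar>f x\<bar> \<partial>lborel)"
      by (rule integral_abs_bound)
    also have "\<dots> \<le> (\<integral>x. B * indicator {0..<1::real} x \<partial>lborel)"
    proof (rule integral_mono)
      show "integrable lborel (\<lambda>x. \<bar>f x\<bar>)"
        using True by simp
      show "integrable lborel (\<lambda>x. B * indicator {0..<1::real} x)"
        by simp
      show "\<bar>f x\<bar> \<le> B * indicator {0..<1} x" for x
        using B z by (auto simp: indicator_def)
    qed
    also have "\<dots> = B"
      by (subst integral_mult_right_zero) simp
    finally show ?thesis .
  qed (simp add: B0 not_integrable_integral_eq)
qed

lemma regular_integrable: "regular f \<Longrightarrow> integrable lborel f"
  unfolding regular_def by (auto intro: integrable_unit_bounded)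

lemma regular_mult:
  assumes f: "regular f" and [measurable]: "g \<in> borel_measurable borel" and g: "\<And>x. \<bar>g x\<bar> \<le> B"
  shows "regular (\<lambda>x. g x * f x)"
proof -
  note [measurable] = regular_measurable[OF f]
  obtain C where C: "0 \<le> C" "\<And>x. \<bar>f x\<bar> \<le> C"
    using regular_bounded[OF f] by blast
  have B: "0 \<le> B" using g[of 0] by linarith
  show ?thesis
  proof (rule regularI[where B = "B * C"])
    show "\<bar>g x * f x\<bar> \<le> B * C" for x
      unfolding abs_mult by (rule mult_mono[OF g C(2) B]) simp
  qed (use regular_outside[OF f] in auto)
qed

lemma regular_add:
  assumes f: "regular f" and g: "regular g"
  shows "regular (\<lambda>x. f x + g x)"
proof -
  note [measurable] = regular_measurable[OF f] regular_measurable[OF g]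
  obtain B C where "\<And>x. \<bar>f x\<bar> \<le> B" "\<And>x. \<bar>g x\<bar> \<le> C"
    using regular_bounded[OF f] regular_bounded[OF g] by metis
  then have "\<bar>f x + g x\<bar> \<le> B + C" for x
    by (meson abs_triangle_ineq add_mono order_trans)
  then show ?thesis
    by (intro regularI[where B = "B + C"]) (use regular_outside[OF f] regular_outside[OF g] in auto)
qed

lemma regular_cmult: "regular f \<Longrightarrow> regular (\<lambda>x. c * f x)"
  by (rule regular_mult[where B = "\<bar>c\<bar>"]) auto

definition unit_fun :: "real \<Rightarrow> real" where
  "unit_fun = indicator {0..<1}"

lemma regular_unit_fun: "regular unit_fun"
  by (rule regularI[where B = 1]) (auto simp: unit_fun_def indicator_def)

section \<open>The transfer operator of a single map\<close>

text \<open>This is the Perron-Frobenius operator of \<open>beta_map b\<close>, summed over all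
  \<open>\<lceil>b\<rceil>\<close> inverse branches. The last branch may be incomplete; where it
  leaves the unit interval, a regular \<open>f\<close> contributes 0, so no case distinction is
  required.\<close>

definition transfer :: "real \<Rightarrow> (real \<Rightarrow> real) \<Rightarrow> real \<Rightarrow> real" where
  "transfer b f y = indicator {0..<1} y * ((\<Sum>j<nat \<lceil>b\<rceil>. f ((y + real j) / b)) / b)"

lemma transfer_add: "transfer b (\<lambda>x. f x + g x) y = transfer b f y + transfer b g y"
  by (simp add: transfer_def sum.distrib add_divide_distrib distrib_left)

lemma transfer_cmult: "transfer b (\<lambda>x. c * f x) y = c * transfer b f y"
  by (simp add: transfer_def sum_distrib_left[symmetric])

lemma regular_transfer:
  assumes b: "1 < b" and f: "regular f"
  shows "regular (transfer b f)"
proof -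
  note [measurable] = regular_measurable[OF f]
  obtain B where B: "0 \<le> B" "\<And>x. \<bar>f x\<bar> \<le> B"
    using regular_bounded[OF f] by blast
  show ?thesis
  proof (rule regularI[where B = "real (nat \<lceil>b\<rceil>) * B / b"])
    show "transfer b f \<in> borel_measurable borel"
      unfolding transfer_def by measurable
    fix y
    have "\<bar>\<Sum>j<nat \<lceil>b\<rceil>. f ((y + real j) / b)\<bar> \<le> (\<Sum>j<nat \<lceil>b\<rceil>. B)"
      by (rule order_trans[OF sum_abs sum_mono]) (rule B)
    then show "\<bar>transfer b f y\<bar> \<le> real (nat \<lceil>b\<rceil>) * B / b"
      using b B(1) by (auto simp: transfer_def indicator_def divide_right_mono)
  qed (simp add: transfer_def)
qed

lemma beta_map_measurable [measurable]: "beta_map b \<in> borel_measurable borel"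
  unfolding beta_map_def by measurable

lemma beta_map_in_unit: "beta_map b x \<in> {0..<1}"
  unfolding beta_map_def by (simp; linarith)

lemma beta_map_branch:
  assumes "0 < b" "y \<in> {0..<1}"
  shows "beta_map b ((y + real j) / b) = y"
proof -
  have "\<lfloor>y + real j\<rfloor> = int j"
    using assms by (simp add: floor_eq_iff)
  then show ?thesis
    using assms by (simp add: beta_map_def)
qed

text \<open>Duality between the operator and composition with the map: the unit interval is cut into
  the cells on which the map is affine, and each cell is rescaled to \<open>{0..<1}\<close>.\<close>

lemma integral_transfer:
  assumes b: "1 < b" and f: "regular f"
    and [measurable]: "g \<in> borel_measurable borel" and g: "\<And>x. \<bar>g x\<bar> \<le> B"
  shows "(\<integral>x. g (beta_map b x) * f x \<partial>lborel) = (\<integral>y. g y * transfer b f y \<partial>lborel)"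
proof -
  note [measurable] = regular_measurable[OF f]
  define N where "N = nat \<lceil>b\<rceil>"
  define F where "F x = g (beta_map b x) * f x" for x
  define J where "J j = {real j / b..<(real j + 1) / b}" for j
  have F: "regular F"
    unfolding F_def by (rule regular_mult[OF f _ g]) measurable
  have mF [measurable]: "F \<in> borel_measurable borel"
    by (rule regular_measurable[OF F])
  \<comment> \<open>The cells \<open>J j\<close> with \<open>j < N\<close> are disjoint and cover
    \<open>{0..<1}\<close>. The last one may reach beyond 1, where \<open>F\<close>
    vanishes.\<close>
  have split: "F x = (\<Sum>j<N. indicator (J j) x * F x)" for x
  proof (cases "x \<in> {0..<1}")
    case True
    define k where "k = nat \<lfloor>b * x\<rfloor>"
    have k: "real k \<le> b * x" "b * x < real k + 1"
      using True b by (auto simp: k_def)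
    have "real k < b"
      using k(1) True b mult_strict_left_mono[of x 1 b] by (auto intro: le_less_trans)
    then have "k < N"
      unfolding N_def by linarith
    have J: "x \<in> J j \<longleftrightarrow> j = k" for j
    proof -
      have "x \<in> J j \<longleftrightarrow> real j \<le> b * x \<and> b * x < real j + 1"
        using b by (simp add: J_def field_simps)
      then show ?thesis using k by linarith
    qed
    have "(\<Sum>j<N. indicator (J j) x * F x) = (\<Sum>j<N. if j = k then F x else 0)"
      by (rule sum.cong) (auto simp: J)
    then show ?thesis using \<open>k < N\<close> by simp
  next
    case False
    then show ?thesis by (simp add: regular_outside[OF F])
  qed
  have integ: "integrable lborel (\<lambda>x. indicator (J j) x * F x)" for j
    using integrable_mult_indicator[OF _ regular_integrable[OF F], of "J j"] by (simp add: J_def)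
  have piece: "(\<integral>x. indicator (J j) x * F x \<partial>lborel)
      = (\<integral>y. g y * (indicator {0..<1} y * f ((y + real j) / b) / b) \<partial>lborel)" for j
  proof -
    \<comment> \<open>The substitution \<open>x = (y + j) / b\<close> maps \<open>{0..<1}\<close>
      onto \<open>J j\<close>, and its factor \<open>1/b\<close> is the weight in
      \<open>transfer\<close>.\<close>
    have "(\<integral>x. indicator (J j) x * F x \<partial>lborel)
        = (1/b) * (\<integral>y. indicator (J j) (real j / b + (1/b) * y) * F (real j / b + (1/b) * y) \<partial>lborel)"
      using b by (subst lborel_integral_real_affine[where c = "1/b" and t = "real j / b"]) auto
    also have "\<dots> = (\<integral>y. (1/b) * (indicator (J j) (real j / b + (1/b) * y) * F (real j / b + (1/b) * y)) \<partial>lborel)"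
      by simp
    also have "\<dots> = (\<integral>y. g y * (indicator {0..<1} y * f ((y + real j) / b) / b) \<partial>lborel)"
    proof (rule Bochner_Integration.integral_cong[OF refl])
      fix y :: real
      have eq: "real j / b + (1/b) * y = (y + real j) / b"
        by (simp add: add_divide_distrib)
      have "indicator (J j) ((y + real j) / b) = (indicator {0..<1} y :: real)"
        using b by (auto simp: J_def indicator_def divide_simps split: if_splits)
      moreover have "F ((y + real j) / b) = g y * f ((y + real j) / b)" if "y \<in> {0..<1}"
        using b that by (simp add: F_def beta_map_branch)
      ultimately show "(1/b) * (indicator (J j) (real j / b + (1/b) * y) * F (real j / b + (1/b) * y))
          = g y * (indicator {0..<1} y * f ((y + real j) / b) / b)"
        unfolding eq by (auto simp: indicator_def)
    qed
    finally show ?thesis .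
  qed
  have branch: "integrable lborel (\<lambda>y. g y * (indicator {0..<1} y * f ((y + real j) / b) / b))" for j
  proof -
    obtain C where C: "0 \<le> C" "\<And>x. \<bar>f x\<bar> \<le> C"
      using regular_bounded[OF f] by blast
    have "regular (\<lambda>y. indicator {0..<1} y * f ((y + real j) / b) / b)"
    proof (rule regularI[where B = "C / b"])
      show "\<bar>indicator {0..<1} y * f ((y + real j) / b) / b\<bar> \<le> C / b" for y :: real
        using b C by (auto simp: indicator_def divide_right_mono)
    qed auto
    from regular_mult[OF this _ g] show ?thesis
      by (intro regular_integrable) simp
  qed
  have "(\<integral>x. F x \<partial>lborel) = (\<integral>x. (\<Sum>j<N. indicator (J j) x * F x) \<partial>lborel)"
    by (simp flip: split)
  also have "\<dots> = (\<Sum>j<N. \<integral>x. indicator (J j) x * F x \<partial>lborel)"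
    by (rule Bochner_Integration.integral_sum) (rule integ)
  also have "\<dots> = (\<Sum>j<N. \<integral>y. g y * (indicator {0..<1} y * f ((y + real j) / b) / b) \<partial>lborel)"
    by (simp only: piece)
  also have "\<dots> = (\<integral>y. (\<Sum>j<N. g y * (indicator {0..<1} y * f ((y + real j) / b) / b)) \<partial>lborel)"
    by (rule Bochner_Integration.integral_sum[symmetric]) (rule branch)
  also have "\<dots> = (\<integral>y. g y * transfer b f y \<partial>lborel)"
    unfolding transfer_def N_def
    by (simp add: sum_distrib_left sum_divide_distrib mult.assoc)
  finally show ?thesis unfolding F_def .
qed

section \<open>The cone of nonnegative decreasing functions\<close>

text \<open>Monotonicity is demanded on the whole half-line, so it includes the drop to 0 at the
  point 1. This is what makes incomplete branches harmless.\<close>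

definition decreasing :: "(real \<Rightarrow> real) \<Rightarrow> bool" where
  "decreasing f \<longleftrightarrow> regular f \<and> (\<forall>x. 0 \<le> f x) \<and> (\<forall>x y. 0 \<le> x \<longrightarrow> x \<le> y \<longrightarrow> f y \<le> f x)"

lemma decreasing_regular: "decreasing f \<Longrightarrow> regular f"
  and decreasing_nonneg: "decreasing f \<Longrightarrow> 0 \<le> f x"
  and decreasing_antimono: "decreasing f \<Longrightarrow> 0 \<le> x \<Longrightarrow> x \<le> y \<Longrightarrow> f y \<le> f x"
  by (auto simp: decreasing_def)

lemma decreasing_le_0: "decreasing f \<Longrightarrow> f x \<le> f 0"
  by (metis atLeastLessThan_iff decreasing_antimono decreasing_nonneg decreasing_regular order_refl regular_outside)

lemma decreasing_unit_fun: "decreasing unit_fun"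
  using regular_unit_fun by (auto simp: decreasing_def unit_fun_def indicator_def)

lemma integral_unit_fun: "(\<integral>x. unit_fun x \<partial>lborel) = 1"
  by (simp add: unit_fun_def)

lemma decreasing_add: "decreasing f \<Longrightarrow> decreasing g \<Longrightarrow> decreasing (\<lambda>x. f x + g x)"
  by (auto simp: decreasing_def intro!: regular_add add_mono)

lemma decreasing_cmult: "decreasing f \<Longrightarrow> 0 \<le> c \<Longrightarrow> decreasing (\<lambda>x. c * f x)"
  by (auto simp: decreasing_def intro!: regular_cmult mult_left_mono)

text \<open>Initial segments, open or closed at the end, and the empty set are treated together.
  Multiplying by the indicator of such a set keeps a function in the cone, which fails for a general
  interval.\<close>

definition down_set :: "real set \<Rightarrow> bool" where
  "down_set D \<longleftrightarrow> D \<in> sets borel \<and> (\<forall>x y. x \<le> y \<longrightarrow> y \<in> D \<longrightarrow> x \<in> D)"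

lemma down_set_measurable: "down_set D \<Longrightarrow> D \<in> sets borel"
  by (simp add: down_set_def)

lemma down_set_atMost: "down_set {..v}" and down_set_lessThan: "down_set {..<v}"
  and down_set_empty: "down_set {}"
  by (auto simp: down_set_def)

lemma regular_cut:
  assumes "regular f" "D \<in> sets borel"
  shows "regular (\<lambda>x. indicator D x * f x)"
  by (rule regular_mult[where B = 1]) (use assms in \<open>auto simp: indicator_def\<close>)

lemma decreasing_cut:
  assumes f: "decreasing f" and D: "down_set D"
  shows "decreasing (\<lambda>x. indicator D x * f x)"
  unfolding decreasing_def
proof (intro conjI allI impI)
  show "regular (\<lambda>x. indicator D x * f x)"
    by (rule regular_cut[OF decreasing_regular[OF f] down_set_measurable[OF D]])
  show "0 \<le> indicator D x * f x" for x
    by (simp add: decreasing_nonneg[OF f])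
  fix x y :: real
  assume "0 \<le> x" "x \<le> y"
  then show "indicator D y * f y \<le> indicator D x * f x"
    using D decreasing_antimono[OF f] decreasing_nonneg[OF f]
    by (cases "y \<in> D") (auto simp: down_set_def)
qed

text \<open>Every inverse branch is increasing in \<open>y\<close>, so each summand decreases, even
  where the last branch passes the point 1.\<close>

lemma decreasing_transfer:
  assumes b: "1 < b" and f: "decreasing f"
  shows "decreasing (transfer b f)"
proof -
  have "transfer b f y \<le> transfer b f x" if xy: "0 \<le> x" "x \<le> y" for x y
  proof (cases "y < 1")
    case True
    have "(\<Sum>j<nat \<lceil>b\<rceil>. f ((y + real j) / b)) \<le> (\<Sum>j<nat \<lceil>b\<rceil>. f ((x + real j) / b))"
      using b xy by (intro sum_mono decreasing_antimono[OF f]) (auto simp: divide_right_mono)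
    then show ?thesis
      using True xy b by (simp add: transfer_def divide_right_mono)
  next
    case False
    then show ?thesis
      using b by (auto simp: transfer_def sum_nonneg decreasing_nonneg[OF f])
  qed
  moreover have "0 \<le> transfer b f x" for x
    using b by (auto simp: transfer_def sum_nonneg decreasing_nonneg[OF f])
  ultimately show ?thesis
    using regular_transfer[OF b decreasing_regular[OF f]] by (auto simp: decreasing_def)
qed

lemma integral_decreasing_nonneg: "decreasing f \<Longrightarrow> 0 \<le> (\<integral>x. f x \<partial>lborel)"
  by (simp add: decreasing_nonneg)

text \<open>The left side is a lower Riemann sum with mesh \<open>1 / b\<close>, since a decreasing
  function takes its smallest value on a cell towards the right endpoint.\<close>

lemma decreasing_left_sum_le_integral:
  assumes b: "1 < b" and f: "decreasing f"
  shows "(\<Sum>j<N. f ((real j + 1) / b)) / b \<le> (\<integral>x. f x \<partial>lborel)"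
proof -
  have m [measurable]: "f \<in> borel_measurable borel"
    by (rule regular_measurable[OF decreasing_regular[OF f]])
  define J where "J j = {real j / b..<(real j + 1) / b}" for j
  have J: "x \<in> J j \<longleftrightarrow> j = nat \<lfloor>b * x\<rfloor> \<and> 0 \<le> x" for x j
  proof -
    have "x \<in> J j \<longleftrightarrow> real j \<le> b * x \<and> b * x < real j + 1"
      using b by (simp add: J_def field_simps)
    moreover have "0 \<le> b * x \<longleftrightarrow> 0 \<le> x"
      using b by (simp add: zero_le_mult_iff)
    moreover have "real j \<le> b * x \<and> b * x < real j + 1 \<longleftrightarrow> j = nat \<lfloor>b * x\<rfloor> \<and> 0 \<le> b * x"
    proof (intro iffI conjI; (elim conjE)?)
      assume "real j \<le> b * x" "b * x < real j + 1"
      then show "j = nat \<lfloor>b * x\<rfloor>" "0 \<le> b * x"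
        using floor_eq_iff[of "b * x" "int j"] by auto
    next
      assume "j = nat \<lfloor>b * x\<rfloor>" "0 \<le> b * x"
      then show "real j \<le> b * x" "b * x < real j + 1"
        by (auto simp: of_nat_floor)
    qed
    ultimately show ?thesis by blast
  qed
  have integ: "integrable lborel (\<lambda>x. indicator (J j) x * f ((real j + 1) / b))" for j
    unfolding J_def using b
    by (intro integrable_mult_left) (auto simp: divide_right_mono)
  have "(\<Sum>j<N. f ((real j + 1) / b)) / b = (\<Sum>j<N. \<integral>x. indicator (J j) x * f ((real j + 1) / b) \<partial>lborel)"
    using b by (simp add: J_def sum_divide_distrib divide_right_mono diff_divide_distrib[symmetric])
  also have "\<dots> = (\<integral>x. (\<Sum>j<N. indicator (J j) x * f ((real j + 1) / b)) \<partial>lborel)"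
    by (rule Bochner_Integration.integral_sum[symmetric]) (rule integ)
  also have "\<dots> \<le> (\<integral>x. f x \<partial>lborel)"
  proof (rule integral_mono)
    show "integrable lborel (\<lambda>x. \<Sum>j<N. indicator (J j) x * f ((real j + 1) / b))"
      by (rule Bochner_Integration.integrable_sum) (rule integ)
    show "integrable lborel f"
      by (rule regular_integrable[OF decreasing_regular[OF f]])
    fix x :: real
    have "indicator (J j) x * f ((real j + 1) / b) \<le> (if j = nat \<lfloor>b * x\<rfloor> then f x else 0)" for j
    proof (cases "x \<in> J j")
      case True
      then have "0 \<le> x" using J by simp
      moreover have "x \<le> (real j + 1) / b" using True unfolding J_def by auto
      ultimately have "f ((real j + 1) / b) \<le> f x"
        by (rule decreasing_antimono[OF f])
      then show ?thesis
        using True J by simp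
    qed (simp add: decreasing_nonneg[OF f])
    then have "(\<Sum>j<N. indicator (J j) x * f ((real j + 1) / b)) \<le> (\<Sum>j<N. if j = nat \<lfloor>b * x\<rfloor> then f x else 0)"
      by (intro sum_mono)
    also have "\<dots> \<le> f x"
      by (simp add: decreasing_nonneg[OF f])
    finally show "(\<Sum>j<N. indicator (J j) x * f ((real j + 1) / b)) \<le> f x" .
  qed
  finally show ?thesis .
qed

text \<open>A Lasota-Yorke inequality in the cone, where \<open>f 0\<close> is the maximum of
  \<open>f\<close>. At \<open>y = 0\<close> the first branch gives \<open>f 0 / b\<close>, and the
  other branches form the lower Riemann sum bounded above.\<close>

lemma transfer_0_le:
  assumes b: "1 < b" and f: "decreasing f"
  shows "transfer b f 0 \<le> f 0 / b + (\<integral>x. f x \<partial>lborel)"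
proof -
  obtain N where N: "nat \<lceil>b\<rceil> = Suc N"
    using b by (metis Suc_pred zero_less_ceiling zero_less_nat_eq less_trans zero_less_one)
  have "transfer b f 0 = f 0 / b + (\<Sum>j<N. f ((real j + 1) / b)) / b"
    by (simp add: transfer_def N sum.lessThan_Suc_shift add_divide_distrib add.commute del: sum.lessThan_Suc)
  then show ?thesis
    using decreasing_left_sum_le_integral[OF b f, of N] by linarith
qed

lemma transfer_ge_first_branch:
  assumes b: "1 < b" and f: "decreasing f" and y: "y \<in> {0..<1}"
  shows "f (y / b) / b \<le> transfer b f y"
proof -
  have "0 < nat \<lceil>b\<rceil>" using b by simp
  then have "f ((y + real 0) / b) \<le> (\<Sum>j<nat \<lceil>b\<rceil>. f ((y + real j) / b))"
    by (intro member_le_sum[of 0 "{..<nat \<lceil>b\<rceil>}" "\<lambda>j. f ((y + real j) / b)"]) (auto simp: decreasing_nonneg[OF f])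
  then show ?thesis
    using b y by (simp add: transfer_def divide_right_mono)
qed

text \<open>The integral is split at \<open>t\<close>, with \<open>f\<close> bounded by
  \<open>f 0\<close> on the left and by \<open>f t\<close> on the right. Read backwards, this bounds
  \<open>f t\<close> below as soon as \<open>t * f 0\<close> is small against the integral.\<close>

lemma decreasing_lower_bound:
  assumes f: "decreasing f" and t: "0 \<le> t" "t < 1"
  shows "(\<integral>x. f x \<partial>lborel) \<le> t * f 0 + f t"
proof -
  have "(\<integral>x. f x \<partial>lborel) \<le> (\<integral>x. f 0 * indicator {0..<t} x + f t * indicator {t..<1} x \<partial>lborel)"
  proof (rule integral_mono[OF regular_integrable[OF decreasing_regular[OF f]]])
    show "f x \<le> f 0 * indicator {0..<t} x + f t * indicator {t..<1} x" for x
      using decreasing_le_0[OF f, of x] decreasing_antimono[OF f t(1), of x] regular_outside[OF decreasing_regular[OF f], of x] t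
      by (cases "x < t"; cases "0 \<le> x"; cases "x < 1") auto
  qed (use t in auto)
  also have "\<dots> = f 0 * t + f t * (1 - t)"
    using t by (subst Bochner_Integration.integral_add) auto
  also have "\<dots> \<le> t * f 0 + f t"
    using t decreasing_nonneg[OF f, of t] by (simp add: algebra_simps)
  finally show ?thesis .
qed

section \<open>Compositions of the maps and of their transfer operators\<close>

locale alternate_base =
  fixes \<beta> :: "real list"
  assumes nonempty: "\<beta> \<noteq> []" and gt_1: "\<And>b. b \<in> set \<beta> \<Longrightarrow> 1 < b"
begin

abbreviation base :: "int \<Rightarrow> real" where
  "base n \<equiv> beta_at \<beta> n"

abbreviation period :: nat where
  "period \<equiv> length \<beta>"

definition lo :: real where "lo = Min (set \<beta>)"
definition hi :: real where "hi = Max (set \<beta>)"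

lemma period_pos: "0 < period"
  using nonempty by simp

lemma base_in_set: "base n \<in> set \<beta>"
proof -
  have "nat (n mod int period) < period"
    using period_pos by (simp add: nat_less_iff)
  then show ?thesis unfolding beta_at_def by (rule nth_mem)
qed

lemma base_gt_1: "1 < base n"
  by (rule gt_1[OF base_in_set])

lemma lo_gt_1: "1 < lo"
  unfolding lo_def using nonempty gt_1 by simp

lemma lo_le_base: "lo \<le> base n"
  unfolding lo_def by (simp add: base_in_set)

lemma base_le_hi: "base n \<le> hi"
  unfolding hi_def by (simp add: base_in_set)

lemma hi_gt_1: "1 < hi"
  using base_gt_1[of 0] base_le_hi[of 0] by linarith

lemma base_add_period: "base (n + int (k * period)) = base n"
  unfolding beta_at_def by simp

lemma beta_comp_add: "beta_comp \<beta> m (k + n) x = beta_comp \<beta> (m + int k) n (beta_comp \<beta> m k x)"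
  by (induction n) (simp_all add: add.assoc)

lemma beta_comp_add_period: "beta_comp \<beta> (m + int (k * period)) n = beta_comp \<beta> m n"
proof (induction n)
  case (Suc n)
  have "base (m + int (k * period) + int n) = base (m + int n)"
    using base_add_period[of "m + int n" k] by (simp add: algebra_simps)
  then show ?case using Suc by simp
qed simp

lemma beta_comp_measurable [measurable]: "beta_comp \<beta> m n \<in> borel_measurable borel"
proof (induction n)
  case (Suc n)
  then show ?case unfolding beta_comp.simps by (rule measurable_comp) (rule beta_map_measurable)
qed simp

lemma beta_comp_in_unit: "x \<in> {0..<1} \<Longrightarrow> beta_comp \<beta> m n x \<in> {0..<1}"
  using beta_map_in_unit by (cases n) auto

primrec transfers :: "int \<Rightarrow> nat \<Rightarrow> (real \<Rightarrow> real) \<Rightarrow> real \<Rightarrow> real" where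
  "transfers m 0 f = f"
| "transfers m (Suc n) f = transfer (base (m + int n)) (transfers m n f)"

lemma transfers_compose: "transfers m (k + n) f = transfers (m + int k) n (transfers m k f)"
  by (induction n) (simp_all add: add.assoc)

lemma transfers_add_period: "transfers (m + int (k * period)) n f = transfers m n f"
proof (induction n)
  case (Suc n)
  have "base (m + int (k * period) + int n) = base (m + int n)"
    using base_add_period[of "m + int n" k] by (simp add: algebra_simps)
  then show ?case using Suc by simp
qed simp

lemma transfers_add: "transfers m n (\<lambda>x. f x + g x) = (\<lambda>x. transfers m n f x + transfers m n g x)"
  by (induction n) (auto simp: transfer_add)

lemma transfers_cmult: "transfers m n (\<lambda>x. c * f x) = (\<lambda>x. c * transfers m n f x)"
  by (induction n) (auto simp: transfer_cmult)

lemma regular_transfers: "regular f \<Longrightarrow> regular (transfers m n f)"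
  by (induction n) (auto intro: regular_transfer base_gt_1)

lemma decreasing_transfers: "decreasing f \<Longrightarrow> decreasing (transfers m n f)"
  by (induction n) (auto intro: decreasing_transfer base_gt_1)

text \<open>\<open>integral_transfer\<close> is iterated by peeling off the last map and absorbing
  it into the test function, hence the induction over arbitrary \<open>g\<close>.\<close>

lemma integral_transfers_mult:
  assumes f: "regular f" and "g \<in> borel_measurable borel" and "\<And>x. \<bar>g x\<bar> \<le> B"
  shows "(\<integral>x. g (beta_comp \<beta> m n x) * f x \<partial>lborel) = (\<integral>y. g y * transfers m n f y \<partial>lborel)"
  using assms(2,3)
proof (induction n arbitrary: g)
  case (Suc n)
  note [measurable] = Suc.prems(1)
  have "(\<integral>x. g (beta_comp \<beta> m (Suc n) x) * f x \<partial>lborel)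
      = (\<integral>x. g (beta_map (base (m + int n)) (beta_comp \<beta> m n x)) * f x \<partial>lborel)"
    by simp
  also have "\<dots> = (\<integral>y. g (beta_map (base (m + int n)) y) * transfers m n f y \<partial>lborel)"
    by (rule Suc.IH[of "\<lambda>y. g (beta_map (base (m + int n)) y)"]) (use Suc.prems in auto)
  also have "\<dots> = (\<integral>y. g y * transfers m (Suc n) f y \<partial>lborel)"
    unfolding transfers.simps
    by (rule integral_transfer[OF base_gt_1 regular_transfers[OF f] Suc.prems])
  finally show ?case .
qed simp

lemma integral_transfers: "regular f \<Longrightarrow> (\<integral>x. transfers m n f x \<partial>lborel) = (\<integral>x. f x \<partial>lborel)"
  using integral_transfers_mult[of f "\<lambda>_. 1" 1 m n] by simp

section \<open>Uniform bounds and geometric contraction\<close>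

text \<open>The number \<open>lo / (lo - 1)\<close> is the fixed point of
  \<open>a \<mapsto> a / lo + 1\<close>, the recursion arising from \<open>transfer_0_le\<close>.
  The factor 4 leaves room for removing up to a quarter of the mass in the contraction
  argument.\<close>

definition cone_const :: real where
  "cone_const = 4 * (lo / (lo - 1))"

lemma cone_const_gt_4: "4 < cone_const"
  unfolding cone_const_def using lo_gt_1 by (simp add: field_simps)

text \<open>The maximum \<open>f 0\<close> is controlled by the integral. Such a function cannot
  concentrate its mass near 0, as the minorization requires.\<close>

definition balanced :: "(real \<Rightarrow> real) \<Rightarrow> bool" where
  "balanced f \<longleftrightarrow> decreasing f \<and> f 0 \<le> cone_const * (\<integral>x. f x \<partial>lborel)"

text \<open>Iteration of \<open>transfer_0_le\<close>: the integral is preserved at each step, and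
  its contributions add up to at most the geometric series with ratio \<open>1 / lo\<close>.\<close>

lemma transfers_0_le:
  assumes f: "decreasing f"
  shows "transfers m n f 0 \<le> f 0 / lo ^ n + cone_const / 4 * (\<integral>x. f x \<partial>lborel)"
proof (induction n)
  case 0
  show ?case
    using cone_const_gt_4 integral_decreasing_nonneg[OF f] by simp
next
  case (Suc n)
  let ?I = "\<integral>x. f x \<partial>lborel"
  have I: "(\<integral>x. transfers m n f x \<partial>lborel) = ?I"
    by (rule integral_transfers[OF decreasing_regular[OF f]])
  have d: "decreasing (transfers m n f)"
    by (rule decreasing_transfers[OF f])
  have "transfers m (Suc n) f 0 \<le> transfers m n f 0 / base (m + int n) + ?I"
    using transfer_0_le[OF base_gt_1 d] by (simp add: I)
  also have "transfers m n f 0 / base (m + int n) \<le> transfers m n f 0 / lo"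
    using lo_gt_1 lo_le_base by (intro divide_left_mono decreasing_nonneg[OF d]) (auto intro!: mult_pos_pos intro: less_le_trans less_trans[OF zero_less_one base_gt_1])
  also have "transfers m n f 0 / lo \<le> (f 0 / lo ^ n + cone_const / 4 * ?I) / lo"
    using Suc lo_gt_1 by (intro divide_right_mono) auto
  also have "(f 0 / lo ^ n + cone_const / 4 * ?I) / lo + ?I = f 0 / lo ^ Suc n + cone_const / 4 * ?I"
    using lo_gt_1 by (simp add: cone_const_def field_simps)
  finally show ?case by simp
qed

text \<open>Only the branch through 0 is kept at every step. The resulting preimage of
  \<open>y\<close> is at most \<open>y / lo ^ n\<close>, and its weight is at least
  \<open>1 / hi ^ n\<close>.\<close>

lemma transfers_ge_first_branch:
  assumes f: "decreasing f" and "y \<in> {0..<1}"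
  shows "f (y / lo ^ n) / hi ^ n \<le> transfers m n f y"
  using assms(2)
proof (induction n arbitrary: y)
  case (Suc n)
  let ?b = "base (m + int n)"
  have b: "1 < ?b" "lo \<le> ?b" "?b \<le> hi"
    by (rule base_gt_1 lo_le_base base_le_hi)+
  have y: "y / ?b \<in> {0..<1}"
    using Suc.prems b by (auto simp: divide_simps)
  have "y / ?b / lo ^ n \<le> y / lo ^ Suc n"
    using Suc.prems b lo_gt_1 by (auto intro!: divide_left_mono mult_right_mono)
  then have "f (y / lo ^ Suc n) \<le> f (y / ?b / lo ^ n)"
    using Suc.prems b lo_gt_1 by (intro decreasing_antimono[OF f]) auto
  then have "f (y / lo ^ Suc n) / hi ^ n / hi \<le> f (y / ?b / lo ^ n) / hi ^ n / ?b"
    using b hi_gt_1 by (intro frac_le divide_right_mono divide_nonneg_nonneg decreasing_nonneg[OF f]) auto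
  also have "\<dots> \<le> transfers m n f (y / ?b) / ?b"
    using Suc.IH[OF y] b by (intro divide_right_mono) auto
  also have "\<dots> \<le> transfers m (Suc n) f y"
    using transfer_ge_first_branch[OF b(1) decreasing_transfers[OF f] Suc.prems] by simp
  finally show ?case by (simp add: mult.commute)
qed simp

text \<open>A balanced function is bounded below near \<open>0\<close>, and the first branch of a long enough
  composition spreads this bound over the unit interval: this is Doeblin's minorization.\<close>

lemma doeblin:
  obtains N c where "0 < N" "0 < c" "c \<le> 1 / 4" "cone_const / lo ^ N \<le> 1 / 2"
    "\<And>m f y. balanced f \<Longrightarrow> y \<in> {0..<1} \<Longrightarrow> c * (\<integral>x. f x \<partial>lborel) \<le> transfers m N f y"
proof -
  have "\<forall>\<^sub>F n in sequentially. 2 * cone_const < lo ^ n"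
    using filterlim_at_top_dense[of "\<lambda>n. lo ^ n" sequentially] filterlim_realpow_sequentially_gt1[of lo] lo_gt_1
      filterlim_at_infinity_imp_filterlim_at_top[of "\<lambda>n. lo ^ n" sequentially] by (auto simp: eventually_sequentially)
  then obtain N where N: "2 * cone_const < lo ^ N"
    by (auto simp: eventually_sequentially)
  have "0 < N" using N cone_const_gt_4 by (cases N) auto
  \<comment> \<open>The factor \<open>1 / 2\<close> is the share of the integral that survives in
    the lower bound for \<open>f (1 / lo ^ N)\<close>. The cap \<open>1 / 4\<close> is what the
    contraction argument can afford to remove.\<close>
  define c where "c = min (1/4) (1 / (2 * hi ^ N))"
  have pos: "0 < lo ^ N" "0 < hi ^ N" using lo_gt_1 hi_gt_1 by auto
  have t: "1 / lo ^ N < 1" "0 \<le> 1 / lo ^ N" "cone_const / lo ^ N \<le> 1 / 2"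
    using N pos cone_const_gt_4 by (auto simp: field_simps)
  show thesis
  proof (rule that[of N c])
    show "0 < N" by fact
    show "0 < c" using pos by (simp add: c_def)
    show "c \<le> 1 / 4" by (simp add: c_def)
    show "cone_const / lo ^ N \<le> 1 / 2" by fact
    fix m f and y :: real
    assume f: "balanced f" and y: "y \<in> {0..<1}"
    let ?I = "\<integral>x. f x \<partial>lborel"
    have d: "decreasing f" and f0: "f 0 \<le> cone_const * ?I"
      using f by (auto simp: balanced_def)
    have I: "0 \<le> ?I" by (rule integral_decreasing_nonneg[OF d])
    \<comment> \<open>With \<open>t = 1 / lo ^ N\<close>, the choice of \<open>N\<close> makes
      \<open>t * f 0\<close> at most half the integral.\<close>
    have "1 / lo ^ N * f 0 \<le> 1 / lo ^ N * (cone_const * ?I)"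
      using f0 t by (intro mult_left_mono) auto
    also have "\<dots> = cone_const / lo ^ N * ?I" by simp
    also have "\<dots> \<le> 1 / 2 * ?I" using t(3) I by (rule mult_right_mono)
    finally have "?I / 2 \<le> f (1 / lo ^ N)"
      using decreasing_lower_bound[OF d t(2,1)] by linarith
    also have "\<dots> \<le> f (y / lo ^ N)"
      using y pos by (intro decreasing_antimono[OF d]) (auto simp: divide_right_mono)
    finally have "?I / 2 / hi ^ N \<le> f (y / lo ^ N) / hi ^ N"
      using pos by (intro divide_right_mono) auto
    also have "\<dots> \<le> transfers m N f y"
      by (rule transfers_ge_first_branch[OF d y])
    finally have "1 / (2 * hi ^ N) * ?I \<le> transfers m N f y" by simp
    moreover have "c * ?I \<le> 1 / (2 * hi ^ N) * ?I"
      using I by (intro mult_right_mono) (auto simp: c_def)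
    ultimately show "c * ?I \<le> transfers m N f y" by linarith
  qed
qed

lemma transfers_le:
  assumes "balanced f"
  shows "transfers m n f y \<le> 2 * cone_const * (\<integral>x. f x \<partial>lborel)"
proof -
  let ?I = "\<integral>x. f x \<partial>lborel"
  have d: "decreasing f" and f0: "f 0 \<le> cone_const * ?I"
    using assms by (auto simp: balanced_def)
  have I: "0 \<le> cone_const * ?I"
    using integral_decreasing_nonneg[OF d] cone_const_gt_4 by simp
  have "f 0 / lo ^ n \<le> f 0"
    using decreasing_nonneg[OF d, of 0] lo_gt_1 by (simp add: divide_le_eq mult_right_le_one_le mult_le_cancel_left1)
  then have "transfers m n f 0 \<le> cone_const * ?I + cone_const / 4 * ?I"
    using transfers_0_le[OF d, of m n] f0 by linarith
  then show ?thesis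
    using decreasing_le_0[OF decreasing_transfers[OF d], of m n y] I by linarith
qed

text \<open>A coupling argument. After \<open>N\<close> steps both images dominate the same multiple
  of \<open>unit_fun\<close>. Subtracting it leaves balanced remainders with the mass reduced by the
  factor \<open>1 - c\<close>, while the removed parts evolve identically and cancel. The constants
  serve all starting indices \<open>m\<close>.\<close>

lemma transfers_contract:
  obtains K r where "0 \<le> K" "0 < r" "r < 1"
    "\<And>m n f g y. balanced f \<Longrightarrow> balanced g \<Longrightarrow> (\<integral>x. f x \<partial>lborel) = (\<integral>x. g x \<partial>lborel)
       \<Longrightarrow> \<bar>transfers m n f y - transfers m n g y\<bar> \<le> K * r ^ n * (\<integral>x. f x \<partial>lborel)"
proof -
  obtain N c where N: "0 < N" and c: "0 < c" "c \<le> 1 / 4" and lo: "cone_const / lo ^ N \<le> 1 / 2"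
    and doeblin: "\<And>m f y. balanced f \<Longrightarrow> y \<in> {0..<1} \<Longrightarrow> c * (\<integral>x. f x \<partial>lborel) \<le> transfers m N f y"
    using doeblin by metis
  \<comment> \<open>One block of \<open>N\<close> steps gains exactly \<open>r ^ N = 1 - c\<close>.
    The denominator in \<open>K\<close> pays for an incomplete block, because
    \<open>K * r ^ n\<close> is at least \<open>2 * cone_const\<close> for
    \<open>n < N\<close>.\<close>
  define r where "r = root N (1 - c)"
  define K where "K = 2 * cone_const / (1 - c)"
  have r: "0 < r" "r < 1" "r ^ N = 1 - c"
    using N c by (auto simp: r_def)
  have K: "0 \<le> K" "K * (1 - c) = 2 * cone_const"
    using c cone_const_gt_4 by (auto simp: K_def)
  define rest where "rest m f x = transfers m N f x + (- (c * (\<integral>x. f x \<partial>lborel))) * unit_fun x" for m f x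
  have rest_integral: "(\<integral>x. rest m f x \<partial>lborel) = (1 - c) * (\<integral>x. f x \<partial>lborel)" if "balanced f" for m f
  proof -
    have reg: "regular f" using that by (simp add: balanced_def decreasing_regular)
    have "(\<integral>x. rest m f x \<partial>lborel) = (\<integral>x. transfers m N f x \<partial>lborel) + (\<integral>x. (- (c * (\<integral>x. f x \<partial>lborel))) * unit_fun x \<partial>lborel)"
      unfolding rest_def
      by (intro Bochner_Integration.integral_add regular_integrable regular_transfers reg regular_cmult regular_unit_fun)
    then show ?thesis
      by (simp add: integral_transfers[OF reg] integral_unit_fun algebra_simps)
  qed
  have rest_balanced: "balanced (rest m f)" if f: "balanced f" for m f
  proof -
    let ?I = "\<integral>x. f x \<partial>lborel"
    have d: "decreasing f" and f0: "f 0 \<le> cone_const * ?I"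
      using f by (auto simp: balanced_def)
    have I: "0 \<le> ?I" by (rule integral_decreasing_nonneg[OF d])
    have dT: "decreasing (transfers m N f)" by (rule decreasing_transfers[OF d])
    have reg: "regular (rest m f)"
      unfolding rest_def by (intro regular_add regular_cmult regular_unit_fun decreasing_regular[OF dT])
    have nonneg: "0 \<le> rest m f x" for x
      using doeblin[OF f, of x m] regular_outside[OF reg, of x]
      by (cases "x \<in> {0..<1}") (auto simp: rest_def unit_fun_def)
    have "rest m f y \<le> rest m f x" if "0 \<le> x" "x \<le> y" for x y
    proof (cases "y < 1")
      case True
      then show ?thesis
        using decreasing_antimono[OF dT that] that by (simp add: rest_def unit_fun_def)
    next
      case False
      then show ?thesis
        using regular_outside[OF reg, of y] nonneg[of x] by simp
    qed
    then have "decreasing (rest m f)"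
      unfolding decreasing_def using reg nonneg by auto
    \<comment> \<open>The remainder stays balanced: after \<open>N\<close> steps the value at 0 has
      fallen to at most three quarters of \<open>cone_const\<close> times the integral, and the
      remaining mass is at least three quarters since \<open>c \<le> 1 / 4\<close>.\<close>
    moreover have "rest m f 0 \<le> cone_const * (\<integral>x. rest m f x \<partial>lborel)"
    proof -
      have "f 0 / lo ^ N \<le> cone_const * ?I / lo ^ N"
        using f0 lo_gt_1 by (intro divide_right_mono) auto
      also have "\<dots> = cone_const / lo ^ N * ?I" by simp
      also have "\<dots> \<le> 1 / 2 * ?I" using lo I by (rule mult_right_mono)
      finally have "transfers m N f 0 \<le> (1 / 2 + cone_const / 4) * ?I"
        using transfers_0_le[OF d, of m N] by (simp add: distrib_right)
      also have "\<dots> \<le> cone_const * (3 / 4) * ?I"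
        using cone_const_gt_4 I by (intro mult_right_mono) auto
      also have "\<dots> \<le> cone_const * (1 - c) * ?I"
        using cone_const_gt_4 I c by (intro mult_right_mono mult_left_mono) auto
      moreover have "rest m f 0 \<le> transfers m N f 0"
        using c I by (simp add: rest_def unit_fun_def)
      ultimately show ?thesis
        by (simp add: rest_integral[OF f])
    qed
    ultimately show ?thesis by (simp add: balanced_def)
  qed
  \<comment> \<open>The last summand depends on \<open>f\<close> only through its integral, so it is
    common to \<open>f\<close> and \<open>g\<close>.\<close>
  have split: "transfers m (N + k) f y
      = transfers (m + int N) k (rest m f) y + c * (\<integral>x. f x \<partial>lborel) * transfers (m + int N) k unit_fun y" for m k f y
  proof -
    have "transfers m N f = (\<lambda>x. rest m f x + c * (\<integral>x. f x \<partial>lborel) * unit_fun x)"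
      by (simp add: rest_def fun_eq_iff)
    then show ?thesis
      by (simp add: transfers_compose transfers_add transfers_cmult)
  qed
  have main: "\<bar>transfers m n f y - transfers m n g y\<bar> \<le> K * r ^ n * (\<integral>x. f x \<partial>lborel)"
    if "balanced f" "balanced g" "(\<integral>x. f x \<partial>lborel) = (\<integral>x. g x \<partial>lborel)" for m n f g y
    using that
  proof (induction n arbitrary: m f g rule: less_induct)
    case (less n)
    note f = less.prems(1) and g = less.prems(2) and eq = less.prems(3)
    have d: "decreasing f" "decreasing g" using f g by (auto simp: balanced_def)
    have I: "0 \<le> (\<integral>x. f x \<partial>lborel)" by (rule integral_decreasing_nonneg[OF d(1)])
    show ?case
    proof (cases "n < N")
      case True
      have "\<bar>transfers m n f y - transfers m n g y\<bar> \<le> 2 * cone_const * (\<integral>x. f x \<partial>lborel)"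
        using transfers_le[OF f, of m n y] transfers_le[OF g, of m n y]
          decreasing_nonneg[OF decreasing_transfers[OF d(1)], of m n y]
          decreasing_nonneg[OF decreasing_transfers[OF d(2)], of m n y]
        unfolding eq by linarith
      also have "\<dots> = K * r ^ N * (\<integral>x. f x \<partial>lborel)"
        by (simp add: r K)
      also have "\<dots> \<le> K * r ^ n * (\<integral>x. f x \<partial>lborel)"
        using True K I r by (intro mult_right_mono mult_left_mono power_decreasing) auto
      finally show ?thesis .
    next
      case False
      define k where "k = n - N"
      have n: "n = N + k" "k < n" using False N by (auto simp: k_def)
      have "\<bar>transfers m n f y - transfers m n g y\<bar>
          = \<bar>transfers (m + int N) k (rest m f) y - transfers (m + int N) k (rest m g) y\<bar>"
        unfolding n(1) split by (simp add: eq)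
      also have "\<dots> \<le> K * r ^ k * (\<integral>x. rest m f x \<partial>lborel)"
        by (rule less.IH[OF n(2)]) (simp_all add: rest_balanced f g rest_integral eq)
      also have "\<dots> = K * r ^ n * (\<integral>x. f x \<partial>lborel)"
        by (simp add: rest_integral[OF f] n(1) power_add r)
      finally show ?thesis .
    qed
  qed
  show thesis
    by (rule that[OF K(1) r(1,2) main])
qed

end

section \<open>Almost sure convergence of averages from variance bounds\<close>

text \<open>Between consecutive squares there are at most \<open>2 * m\<close> steps beyond
  \<open>m\<^sup>2\<close>, each changing \<open>s\<close> by at most 1. This is negligible against
  \<open>m\<^sup>2\<close>.\<close>

lemma LIMSEQ_div_from_squares:
  fixes s :: "nat \<Rightarrow> real"
  assumes step: "\<And>k. \<bar>s (Suc k) - s k\<bar> \<le> 1"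
    and sq: "(\<lambda>m. s (m\<^sup>2) / real (m\<^sup>2)) \<longlonglongrightarrow> 0"
  shows "(\<lambda>n. s n / real n) \<longlonglongrightarrow> 0"
proof (rule Lim_null_comparison)
  have dist: "\<bar>s (k + j) - s k\<bar> \<le> real j" for k j
  proof (induction j)
    case (Suc j)
    then show ?case using step[of "k + j"] by simp
  qed simp
  show "\<forall>\<^sub>F n in sequentially. norm (s n / real n)
      \<le> \<bar>s ((floor_sqrt n)\<^sup>2) / real ((floor_sqrt n)\<^sup>2)\<bar> + 2 / real (floor_sqrt n)"
  proof (rule eventually_sequentiallyI)
    fix n :: nat
    assume n: "1 \<le> n"
    define m where "m = floor_sqrt n"
    have m: "0 < m" "m\<^sup>2 \<le> n" "n < (Suc m)\<^sup>2"
      using n Suc_floor_sqrt_power2_gt by (auto simp: m_def)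
    have "n - m\<^sup>2 \<le> 2 * m"
      using m(3) by (simp add: power2_eq_square)
    then have "\<bar>s n - s (m\<^sup>2)\<bar> \<le> 2 * real m"
      using dist[of "m\<^sup>2" "n - m\<^sup>2"] m(2) by (simp del: of_nat_diff)
    then have "\<bar>s n\<bar> \<le> \<bar>s (m\<^sup>2)\<bar> + 2 * real m" by linarith
    then have "\<bar>s n\<bar> / real n \<le> (\<bar>s (m\<^sup>2)\<bar> + 2 * real m) / real (m\<^sup>2)"
      using m by (intro frac_le) (auto simp del: of_nat_power)
    also have "\<dots> = \<bar>s (m\<^sup>2) / real (m\<^sup>2)\<bar> + 2 / real m"
      using m by (simp add: add_divide_distrib power2_eq_square)
    finally show "norm (s n / real n) \<le> \<bar>s ((floor_sqrt n)\<^sup>2) / real ((floor_sqrt n)\<^sup>2)\<bar> + 2 / real (floor_sqrt n)"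
      by (simp add: m_def)
  qed
  have top: "filterlim floor_sqrt at_top sequentially"
    unfolding filterlim_at_top
    by (auto simp: eventually_sequentially le_floor_sqrt_iff)
  have "(\<lambda>n. \<bar>s ((floor_sqrt n)\<^sup>2) / real ((floor_sqrt n)\<^sup>2)\<bar>) \<longlonglongrightarrow> 0"
    using filterlim_compose[OF sq top] by (rule tendsto_rabs_zero)
  moreover have "(\<lambda>n. 2 / real (floor_sqrt n)) \<longlonglongrightarrow> 0"
    using filterlim_compose[OF lim_const_over_n[of 2] top] by simp
  ultimately show "(\<lambda>n. \<bar>s ((floor_sqrt n)\<^sup>2) / real ((floor_sqrt n)\<^sup>2)\<bar> + 2 / real (floor_sqrt n)) \<longlonglongrightarrow> 0"
    by (rule tendsto_add_zero)
qed

text \<open>By monotone convergence the sum of the \<open>Z n\<close> has finite integral, so it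
  converges almost everywhere and its terms tend to 0.\<close>

lemma AE_tendsto_0_of_summable_integrals:
  fixes Z :: "nat \<Rightarrow> 'a \<Rightarrow> real"
  assumes [measurable]: "\<And>n. Z n \<in> borel_measurable M" and nonneg: "\<And>n x. 0 \<le> Z n x"
    and int: "\<And>n. integrable M (Z n)" and summable: "summable (\<lambda>n. \<integral>x. Z n x \<partial>M)"
  shows "AE x in M. (\<lambda>n. Z n x) \<longlonglongrightarrow> 0"
proof -
  have "(\<integral>\<^sup>+x. (\<Sum>n. ennreal (Z n x)) \<partial>M) = (\<Sum>n. \<integral>\<^sup>+x. ennreal (Z n x) \<partial>M)"
    by (rule nn_integral_suminf) measurable
  also have "\<dots> = (\<Sum>n. ennreal (\<integral>x. Z n x \<partial>M))"
    by (simp add: nn_integral_eq_integral int nonneg)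
  also have "\<dots> = ennreal (\<Sum>n. \<integral>x. Z n x \<partial>M)"
    by (rule suminf_ennreal2[OF _ summable]) (simp add: nonneg)
  finally have "(\<integral>\<^sup>+x. (\<Sum>n. ennreal (Z n x)) \<partial>M) \<noteq> \<infinity>" by simp
  then have "AE x in M. (\<Sum>n. ennreal (Z n x)) \<noteq> \<infinity>"
    by (rule nn_integral_PInf_AE[rotated]) measurable
  then show ?thesis
  proof (rule AE_mp, intro AE_I2 impI)
    fix x assume "(\<Sum>n. ennreal (Z n x)) \<noteq> \<infinity>"
    then have "summable (\<lambda>n. Z n x)"
      by (intro summable_suminf_not_top) (auto simp: nonneg)
    then show "(\<lambda>n. Z n x) \<longlonglongrightarrow> 0" by (rule summable_LIMSEQ_zero)
  qed
qed

text \<open>Along \<open>n = m\<^sup>2\<close> the second moment of the average is at most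
  \<open>D / m\<^sup>2\<close>, which is summable. The bounded increments then fill the gaps between
  squares.\<close>

lemma (in finite_measure) AE_average_tendsto_0:
  fixes Y :: "nat \<Rightarrow> 'a \<Rightarrow> real"
  assumes [measurable]: "\<And>k. Y k \<in> borel_measurable M" and bound: "\<And>k x. \<bar>Y k x\<bar> \<le> 1"
    and var: "\<And>n. (\<integral>x. (\<Sum>k<n. Y k x)\<^sup>2 \<partial>M) \<le> D * real n"
  shows "AE x in M. (\<lambda>n. (\<Sum>k<n. Y k x) / real n) \<longlonglongrightarrow> 0"
proof -
  define S where "S n x = (\<Sum>k<n. Y k x)" for n x
  define Z where "Z m x = (S (m\<^sup>2) x / real (m\<^sup>2))\<^sup>2" for m x
  have [measurable]: "S n \<in> borel_measurable M" for n
    unfolding S_def by measurable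
  have "\<bar>S n x\<bar> \<le> real n" for n x
    unfolding S_def by (rule order_trans[OF sum_abs]) (use sum_mono[of "{..<n}" "\<lambda>k. \<bar>Y k x\<bar>" "\<lambda>_. 1"] bound in simp)
  then have S2: "(S n x)\<^sup>2 \<le> (real n)\<^sup>2" for n x
    by (rule abs_le_square_iff[THEN iffD1, of _ "real n", simplified])
  have intS: "integrable M (\<lambda>x. (S n x)\<^sup>2)" for n
    by (rule integrable_const_bound[where B = "(real n)\<^sup>2"]) (auto simp: S2)
  have Z_eq: "Z m x = (S (m\<^sup>2) x)\<^sup>2 / (real (m\<^sup>2))\<^sup>2" for m x
    by (simp add: Z_def power_divide)
  have "AE x in M. (\<lambda>m. Z m x) \<longlonglongrightarrow> 0"
  proof (rule AE_tendsto_0_of_summable_integrals)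
    show "Z m \<in> borel_measurable M" for m
      unfolding Z_def by measurable
    show "0 \<le> Z m x" for m x by (simp add: Z_def)
    show intZ: "integrable M (Z m)" for m
      unfolding Z_eq[abs_def] using intS by simp
    show "summable (\<lambda>m. \<integral>x. Z m x \<partial>M)"
    proof (rule summable_comparison_test'[where N = 0])
      show "summable (\<lambda>m. D * inverse ((real m)\<^sup>2))"
        using inverse_power_summable[of 2, where 'a = real] by (intro summable_mult) simp
      fix m :: nat
      have "(\<integral>x. Z m x \<partial>M) = (\<integral>x. (S (m\<^sup>2) x)\<^sup>2 \<partial>M) / (real (m\<^sup>2))\<^sup>2"
        unfolding Z_eq by simp
      also have "\<dots> \<le> D * real (m\<^sup>2) / (real (m\<^sup>2))\<^sup>2"
        using var[of "m\<^sup>2"] by (intro divide_right_mono) (simp_all add: S_def)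
      \<comment> \<open>For \<open>m = 0\<close> both sides are 0, since division by 0 yields
        0.\<close>
      also have "\<dots> = D * inverse ((real m)\<^sup>2)"
        by (cases "m = 0") (auto simp: power2_eq_square field_simps)
      finally show "norm (\<integral>x. Z m x \<partial>M) \<le> D * inverse ((real m)\<^sup>2)"
        by (simp add: Z_def)
    qed
  qed
  then show ?thesis
  proof (rule AE_mp, intro AE_I2 impI)
    fix x assume "(\<lambda>m. Z m x) \<longlonglongrightarrow> 0"
    then have "(\<lambda>m. S (m\<^sup>2) x / real (m\<^sup>2)) \<longlonglongrightarrow> 0"
      unfolding Z_def by (simp add: tendsto_power_zero tendsto_zero_powrI power_tendsto_0_iff)
    then have "(\<lambda>n. S n x / real n) \<longlonglongrightarrow> 0"
      by (intro LIMSEQ_div_from_squares) (auto simp: S_def bound)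
    then show "(\<lambda>n. (\<Sum>k<n. Y k x) / real n) \<longlonglongrightarrow> 0" by (simp add: S_def)
  qed
qed

text \<open>Passing from \<open>n\<close> to \<open>n + 1\<close> adds one diagonal term, at most
  \<open>K\<close>, and twice the covariances with earlier terms, bounded together by a geometric
  series.\<close>

lemma integral_square_sum_le:
  fixes Y :: "nat \<Rightarrow> 'a \<Rightarrow> real"
  assumes int: "\<And>j k. integrable M (\<lambda>x. Y j x * Y k x)" and r: "0 < r" "r < 1" and K: "0 \<le> K"
    and cov: "\<And>j n. (\<integral>x. Y j x * Y (j + n) x \<partial>M) \<le> K * r ^ n"
  shows "(\<integral>x. (\<Sum>k<n. Y k x)\<^sup>2 \<partial>M) \<le> (K + 2 * K / (1 - r)) * real n"
proof (induction n)
  case (Suc n)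
  let ?S = "\<lambda>n x. \<Sum>k<n. Y k x"
  have int_last: "integrable M (\<lambda>x. \<Sum>k<n. Y k x * Y n x)"
    by (intro Bochner_Integration.integrable_sum int)
  have int_S: "integrable M (\<lambda>x. (?S n x)\<^sup>2)"
    unfolding power2_eq_square sum_product by (intro Bochner_Integration.integrable_sum int)
  have "(\<Sum>k<n. \<integral>x. Y k x * Y n x \<partial>M) \<le> (\<Sum>k<n. K * r ^ (n - k))"
    using cov[of _ "n - _"] by (intro sum_mono) (metis le_add_diff_inverse less_imp_le lessThan_iff)
  \<comment> \<open>Lowering the exponent by one only enlarges the sum, and reversing its order then
    gives the powers from 0 to \<open>n - 1\<close>.\<close>
  also have "\<dots> \<le> (\<Sum>k<n. K * r ^ (n - Suc k))"
    using r K by (intro sum_mono mult_left_mono power_decreasing) auto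
  also have "\<dots> = K * (\<Sum>k<n. r ^ k)"
    by (simp add: sum_distrib_left[symmetric] sum.nat_diff_reindex)
  also have "\<dots> \<le> K * (1 / (1 - r))"
    using r K by (intro mult_left_mono) (auto simp: sum_gp_strict divide_right_mono)
  finally have cross: "(\<Sum>k<n. \<integral>x. Y k x * Y n x \<partial>M) \<le> K / (1 - r)" by simp
  have "(\<integral>x. (?S (Suc n) x)\<^sup>2 \<partial>M) = (\<integral>x. (?S n x)\<^sup>2 + (2 * (\<Sum>k<n. Y k x * Y n x) + Y n x * Y n x) \<partial>M)"
    by (simp add: power2_sum power2_eq_square[of "Y n _"] sum_distrib_right[symmetric] ac_simps)
  also have "\<dots> = (\<integral>x. (?S n x)\<^sup>2 \<partial>M) + ((\<integral>x. 2 * (\<Sum>k<n. Y k x * Y n x) \<partial>M) + (\<integral>x. Y n x * Y n x \<partial>M))"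
    by (subst Bochner_Integration.integral_add; (intro Bochner_Integration.integrable_add integrable_mult_right int_S int_last int)?)+ simp
  also have "(\<integral>x. 2 * (\<Sum>k<n. Y k x * Y n x) \<partial>M) = 2 * (\<Sum>k<n. \<integral>x. Y k x * Y n x \<partial>M)"
    by (subst integral_mult_right_zero, subst Bochner_Integration.integral_sum) (auto intro: int)
  finally have "(\<integral>x. (?S (Suc n) x)\<^sup>2 \<partial>M) \<le> (K + 2 * K / (1 - r)) * real n + (2 * (K / (1 - r)) + K)"
    using Suc cross cov[of n 0] by simp
  then show ?case by (simp add: algebra_simps add_divide_distrib)
qed simp

section \<open>Decay of correlations and the strong law for visits\<close>

lemma prob_space_unit_lborel: "prob_space unit_lborel"
  by (rule prob_spaceI) (simp add: emeasure_restrict_space)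

lemma integral_unit_lborel: "(\<integral>x. f x \<partial>unit_lborel) = (\<integral>x. f x * unit_fun x \<partial>lborel)"
  for f :: "real \<Rightarrow> real"
  by (subst integral_restrict_space) (auto simp: unit_fun_def mult.commute)

lemma integral_regular_minus:
  assumes "regular f" "regular g"
  shows "(\<integral>x. f x - c * g x \<partial>lborel) = (\<integral>x. f x \<partial>lborel) - c * (\<integral>x. g x \<partial>lborel)"
  by (subst Bochner_Integration.integral_diff) (auto intro: regular_integrable assms regular_cmult)

context alternate_base
begin

text \<open>By duality (\<open>integral_visit\<close>) this is the Lebesgue probability that the
  orbit started at index \<open>m\<close> lies in \<open>D k\<close> at time \<open>k\<close>. The
  target depends on time because the digit intervals depend on the current base.\<close>

definition visit_prob :: "int \<Rightarrow> (nat \<Rightarrow> real set) \<Rightarrow> nat \<Rightarrow> real" where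
  "visit_prob m D k = (\<integral>y. indicator (D k) y * transfers m k unit_fun y \<partial>lborel)"

text \<open>The bound is half of what balance requires. The spare half is used in
  \<open>correlation_decay\<close> to add a second function of the same size.\<close>

lemma transfers_unit_fun_0_le: "transfers m n unit_fun 0 \<le> cone_const / 2"
proof -
  have "unit_fun 0 / lo ^ n \<le> 1"
    using lo_gt_1 by (simp add: unit_fun_def)
  then show ?thesis
    using transfers_0_le[OF decreasing_unit_fun, of m n] cone_const_gt_4 by (simp add: integral_unit_fun)
qed

lemma integral_transfers_unit_fun: "(\<integral>x. transfers m n unit_fun x \<partial>lborel) = 1"
  by (simp add: integral_transfers[OF regular_unit_fun] integral_unit_fun)

lemma balanced_transfers_unit_fun: "balanced (transfers m n unit_fun)"
  unfolding balanced_def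
  using transfers_unit_fun_0_le[of m n] cone_const_gt_4
  by (simp add: decreasing_transfers[OF decreasing_unit_fun] integral_transfers_unit_fun)

lemma visit_prob_bounds:
  assumes "D k \<in> sets borel"
  shows "0 \<le> visit_prob m D k" "visit_prob m D k \<le> 1"
proof -
  let ?f = "transfers m k unit_fun"
  have d: "decreasing ?f" by (rule decreasing_transfers[OF decreasing_unit_fun])
  show "0 \<le> visit_prob m D k"
    unfolding visit_prob_def by (intro integral_nonneg_AE AE_I2) (simp add: decreasing_nonneg[OF d])
  have "visit_prob m D k \<le> (\<integral>y. ?f y \<partial>lborel)"
    unfolding visit_prob_def
  proof (rule integral_mono)
    show "integrable lborel (\<lambda>y. indicator (D k) y * ?f y)"
      by (intro regular_integrable regular_cut decreasing_regular[OF d] assms)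
    show "integrable lborel ?f"
      by (intro regular_integrable decreasing_regular[OF d])
  qed (auto simp: indicator_def decreasing_nonneg[OF d])
  then show "visit_prob m D k \<le> 1" by (simp add: integral_transfers_unit_fun)
qed

text \<open>Conditioning on a visit at time \<open>j\<close> replaces the density \<open>h\<close>
  by \<open>cut\<close>, and the contraction makes its image after \<open>n\<close> more steps close
  to that of \<open>?p * h\<close>.\<close>

lemma correlation_decay:
  assumes D: "\<And>k. down_set (D k)"
  obtains K r where "0 \<le> K" "0 < r" "r < 1"
    "\<forall>j n. \<bar>(\<integral>x. indicator (D j) (beta_comp \<beta> m j x) * indicator (D (j + n)) (beta_comp \<beta> m (j + n) x) * unit_fun x \<partial>lborel)
        - visit_prob m D j * visit_prob m D (j + n)\<bar> \<le> K * r ^ n"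
proof -
  obtain K r where K: "0 \<le> K" and r: "0 < r" "r < 1"
    and contract: "\<And>m n f g y. balanced f \<Longrightarrow> balanced g \<Longrightarrow> (\<integral>x. f x \<partial>lborel) = (\<integral>x. g x \<partial>lborel)
       \<Longrightarrow> \<bar>transfers m n f y - transfers m n g y\<bar> \<le> K * r ^ n * (\<integral>x. f x \<partial>lborel)"
    using transfers_contract by metis
  have main: "\<bar>(\<integral>x. indicator (D j) (beta_comp \<beta> m j x) * indicator (D (j + n)) (beta_comp \<beta> m (j + n) x) * unit_fun x \<partial>lborel)
        - visit_prob m D j * visit_prob m D (j + n)\<bar> \<le> 2 * K * r ^ n"
    for j n
  proof -
    note [measurable] = down_set_measurable[OF D]
    let ?p = "visit_prob m D j" and ?E = "D (j + n)"
    define h where "h = transfers m j unit_fun"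
    define cut where "cut x = indicator (D j) x * h x" for x
    have h: "decreasing h" "regular h" "balanced h" "(\<integral>x. h x \<partial>lborel) = 1"
      unfolding h_def
      by (simp_all add: decreasing_transfers decreasing_unit_fun regular_transfers regular_unit_fun
          balanced_transfers_unit_fun integral_transfers_unit_fun)
    have h0: "h 0 \<le> cone_const / 2"
      unfolding h_def by (rule transfers_unit_fun_0_le)
    have cut: "decreasing cut" "regular cut" "(\<integral>x. cut x \<partial>lborel) = ?p"
      unfolding cut_def[abs_def] using decreasing_cut[OF h(1) D[of j]]
      by (simp_all add: decreasing_regular visit_prob_def h_def)
    have p: "0 \<le> ?p" "?p \<le> 1" using visit_prob_bounds[of D j m] by simp_all
    let ?T = "transfers (m + int j) n"
    have "(\<integral>x. indicator (D j) (beta_comp \<beta> m j x) * indicator ?E (beta_comp \<beta> m (j + n) x) * unit_fun x \<partial>lborel)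
        = (\<integral>x. (\<lambda>y. indicator (D j) y * indicator ?E (beta_comp \<beta> (m + int j) n y)) (beta_comp \<beta> m j x) * unit_fun x \<partial>lborel)"
      by (simp add: beta_comp_add)
    also have "\<dots> = (\<integral>y. (indicator (D j) y * indicator ?E (beta_comp \<beta> (m + int j) n y)) * h y \<partial>lborel)"
      unfolding h_def
      by (rule integral_transfers_mult[where B = 1, OF regular_unit_fun]) (auto simp: indicator_def)
    also have "\<dots> = (\<integral>y. indicator ?E (beta_comp \<beta> (m + int j) n y) * cut y \<partial>lborel)"
      by (simp add: cut_def ac_simps)
    also have "\<dots> = (\<integral>y. indicator ?E y * ?T cut y \<partial>lborel)"
      by (rule integral_transfers_mult[where B = 1, OF cut(2)]) (auto simp: indicator_def)
    finally have corr: "(\<integral>x. indicator (D j) (beta_comp \<beta> m j x) * indicator ?E (beta_comp \<beta> m (j + n) x) * unit_fun x \<partial>lborel)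
        = (\<integral>y. indicator ?E y * ?T cut y \<partial>lborel)" .
    have prod: "?p * visit_prob m D (j + n) = ?p * (\<integral>y. indicator ?E y * ?T h y \<partial>lborel)"
      by (simp add: visit_prob_def[of m D "j + n"] transfers_compose h_def)
    \<comment> \<open>When \<open>?p\<close> is small, \<open>cut\<close> alone may violate balance.
      Adding \<open>h\<close> to it, and comparing with \<open>(1 + ?p) * h\<close>, restores
      balance with a constant independent of \<open>?p\<close>; by linearity the added
      \<open>h\<close> cancels in the difference.\<close>
    have "balanced (\<lambda>x. cut x + h x)"
      unfolding balanced_def
    proof
      show "decreasing (\<lambda>x. cut x + h x)" by (intro decreasing_add cut h)
      have I: "(\<integral>x. cut x + h x \<partial>lborel) = ?p + 1"
        by (subst Bochner_Integration.integral_add) (auto intro: regular_integrable cut h simp: cut(3) h(4))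
      have "cut 0 + h 0 \<le> cone_const"
        using h0 decreasing_nonneg[OF h(1), of 0] by (auto simp: cut_def indicator_def)
      also have "\<dots> \<le> cone_const * (?p + 1)"
        using p cone_const_gt_4 by (simp add: mult_le_cancel_left1)
      finally show "cut 0 + h 0 \<le> cone_const * (\<integral>x. cut x + h x \<partial>lborel)" by (simp add: I)
    qed
    moreover have "balanced (\<lambda>x. (1 + ?p) * h x)"
    proof -
      have "(1 + ?p) * h 0 \<le> (1 + ?p) * (cone_const * 1)"
        using h(3,4) p by (intro mult_left_mono) (auto simp: balanced_def)
      then show ?thesis
        using p h decreasing_cmult[OF h(1), of "1 + ?p"] by (simp add: balanced_def ac_simps)
    qed
    moreover have I: "(\<integral>x. cut x + h x \<partial>lborel) = 1 + ?p"
      by (subst Bochner_Integration.integral_add) (auto intro: regular_integrable cut h simp: cut(3) h(4))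
    moreover have "(\<integral>x. (1 + ?p) * h x \<partial>lborel) = 1 + ?p"
      by (simp add: h(4))
    ultimately have c: "\<bar>?T (\<lambda>x. cut x + h x) y - ?T (\<lambda>x. (1 + ?p) * h x) y\<bar> \<le> K * r ^ n * (1 + ?p)" for y
      using contract[of "\<lambda>x. cut x + h x" "\<lambda>x. (1 + ?p) * h x"] by simp
    have diff: "\<bar>?T cut y - ?p * ?T h y\<bar> \<le> 2 * K * r ^ n" for y
    proof -
      have "?T (\<lambda>x. cut x + h x) y - ?T (\<lambda>x. (1 + ?p) * h x) y = ?T cut y - ?p * ?T h y"
        unfolding transfers_add transfers_cmult by (simp add: algebra_simps)
      moreover have "K * r ^ n * (1 + ?p) \<le> K * r ^ n * 2"
        using K r p by (intro mult_left_mono) auto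
      ultimately show ?thesis using c[of y] by simp
    qed
    have reg: "regular (?T cut)" "regular (?T h)"
      by (intro regular_transfers cut h)+
    have "(\<integral>y. indicator ?E y * ?T cut y \<partial>lborel) - ?p * (\<integral>y. indicator ?E y * ?T h y \<partial>lborel)
        = (\<integral>y. indicator ?E y * ?T cut y - ?p * (indicator ?E y * ?T h y) \<partial>lborel)"
      by (rule integral_regular_minus[symmetric]) (intro regular_cut reg; measurable)+
    also have "\<bar>\<dots>\<bar> \<le> 2 * K * r ^ n"
    proof (rule abs_integral_unit_le)
      show "\<bar>indicator ?E y * ?T cut y - ?p * (indicator ?E y * ?T h y)\<bar> \<le> 2 * K * r ^ n" for y
        using diff[of y] K r by (auto simp: indicator_def)
    qed (simp add: regular_outside[OF reg(1)] regular_outside[OF reg(2)])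
    finally show ?thesis
      by (simp only: corr prod)
  qed
  show thesis
    by (rule that[of "2 * K" r]) (use K r main in auto)
qed

lemma integral_visit:
  assumes [measurable]: "D k \<in> sets borel"
  shows "(\<integral>x. indicator (D k) (beta_comp \<beta> m k x) * unit_fun x \<partial>lborel) = visit_prob m D k"
  unfolding visit_prob_def
  by (rule integral_transfers_mult[where B = 1, OF regular_unit_fun]) (auto simp: indicator_def)

text \<open>The centred visit indicators have geometrically decaying covariances, so their sums have
  variance of linear order.\<close>

theorem strong_law:
  assumes D: "\<And>k. down_set (D k)"
  shows "AE x in unit_lborel.
    (\<lambda>n. (\<Sum>k<n. indicator (D k) (beta_comp \<beta> m k x) - visit_prob m D k) / real n) \<longlonglongrightarrow> 0"
proof -
  interpret prob_space unit_lborel by (rule prob_space_unit_lborel)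
  note [measurable] = down_set_measurable[OF D]
  obtain K r where K: "0 \<le> K" and r: "0 < r" "r < 1"
    and decay: "\<forall>j n. \<bar>(\<integral>x. indicator (D j) (beta_comp \<beta> m j x) * indicator (D (j + n)) (beta_comp \<beta> m (j + n) x) * unit_fun x \<partial>lborel)
        - visit_prob m D j * visit_prob m D (j + n)\<bar> \<le> K * r ^ n"
    by (rule correlation_decay[where m = m, OF D]) (rule that)
  let ?X = "\<lambda>k x. indicator (D k) (beta_comp \<beta> m k x) :: real"
  let ?p = "\<lambda>k. visit_prob m D k"
  define Y where "Y k x = ?X k x - ?p k" for k x
  have mX: "?X k \<in> borel_measurable borel" for k by measurable
  have mY: "Y k \<in> borel_measurable borel" for k unfolding Y_def by measurable
  then have mY' [measurable]: "Y k \<in> borel_measurable unit_lborel" for k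
    by (auto intro: measurable_restrict_space1)
  have Y: "\<bar>Y k x\<bar> \<le> 1" for k x
    using visit_prob_bounds[of D k m] by (auto simp: Y_def indicator_def)
  have YY: "\<bar>Y j x * Y k x\<bar> \<le> 1" for j k x
    unfolding abs_mult by (rule mult_le_one) (auto simp: Y)
  have int: "integrable unit_lborel (\<lambda>x. Y j x * Y k x)" for j k
    by (rule integrable_const_bound[where B = 1]) (auto simp: YY)
  have cov: "(\<integral>x. Y j x * Y (j + n) x \<partial>unit_lborel) \<le> K * r ^ n" for j n
  proof -
    let ?k = "j + n"
    have reg: "regular (\<lambda>x. ?X j x * unit_fun x)" "regular (\<lambda>x. ?X ?k x * unit_fun x)"
        "regular (\<lambda>x. ?X j x * ?X ?k x * unit_fun x)"
      by (intro regular_mult[where B = 1] regular_unit_fun; simp add: indicator_def)+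
    have "(\<integral>x. Y j x * Y ?k x \<partial>unit_lborel) = (\<integral>x. Y j x * Y ?k x * unit_fun x \<partial>lborel)"
      by (rule integral_unit_lborel)
    \<comment> \<open>The product is regrouped into differences of regular functions. The second
      bracket is the centred visit at time \<open>j + n\<close>, whose integral vanishes.\<close>
    also have "\<dots> = (\<integral>x. ((?X j x * ?X ?k x * unit_fun x - ?p ?k * (?X j x * unit_fun x))
        - ?p j * (?X ?k x * unit_fun x + (- ?p ?k) * unit_fun x)) \<partial>lborel)"
      by (simp add: Y_def algebra_simps)
    also have "\<dots> = (\<integral>x. ?X j x * ?X ?k x * unit_fun x - ?p ?k * (?X j x * unit_fun x) \<partial>lborel)
        - ?p j * (\<integral>x. ?X ?k x * unit_fun x + (- ?p ?k) * unit_fun x \<partial>lborel)"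
    proof (rule integral_regular_minus)
      have "regular (\<lambda>x. ?X j x * ?X ?k x * unit_fun x + (- ?p ?k) * (?X j x * unit_fun x))"
        by (intro regular_add regular_cmult reg)
      then show "regular (\<lambda>x. ?X j x * ?X ?k x * unit_fun x - ?p ?k * (?X j x * unit_fun x))" by simp
      show "regular (\<lambda>x. ?X ?k x * unit_fun x + (- ?p ?k) * unit_fun x)"
        by (intro regular_add regular_cmult reg regular_unit_fun)
    qed
    also have "(\<integral>x. ?X j x * ?X ?k x * unit_fun x - ?p ?k * (?X j x * unit_fun x) \<partial>lborel)
        = (\<integral>x. ?X j x * ?X ?k x * unit_fun x \<partial>lborel) - ?p ?k * (\<integral>x. ?X j x * unit_fun x \<partial>lborel)"
      by (intro integral_regular_minus reg)
    also have "(\<integral>x. ?X ?k x * unit_fun x + (- ?p ?k) * unit_fun x \<partial>lborel) = 0"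
      by (subst Bochner_Integration.integral_add)
        (auto intro: regular_integrable reg regular_unit_fun regular_cmult simp: integral_visit integral_unit_fun)
    also have "(\<integral>x. ?X j x * unit_fun x \<partial>lborel) = ?p j"
      by (rule integral_visit) measurable
    finally have "(\<integral>x. Y j x * Y ?k x \<partial>unit_lborel)
        = (\<integral>x. ?X j x * ?X ?k x * unit_fun x \<partial>lborel) - ?p ?k * ?p j - ?p j * 0" .
    moreover have "(\<integral>x. ?X j x * ?X ?k x * unit_fun x \<partial>lborel) - ?p j * ?p ?k \<le> K * r ^ n"
      using decay by (meson abs_le_D1)
    ultimately show ?thesis
      by (simp only: mult.commute[of "?p ?k"] mult_zero_right diff_zero)
  qed
  have "AE x in unit_lborel. (\<lambda>n. (\<Sum>k<n. Y k x) / real n) \<longlonglongrightarrow> 0"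
    by (rule AE_average_tendsto_0[OF mY' Y]) (rule integral_square_sum_le[OF int r K cov])
  then show ?thesis by (simp add: Y_def)
qed

end

section \<open>Cesaro means of asymptotically periodic sequences\<close>

lemma cesaro_null:
  fixes e :: "nat \<Rightarrow> real"
  assumes "e \<longlonglongrightarrow> 0"
  shows "(\<lambda>n. (\<Sum>k<n. e k) / real n) \<longlonglongrightarrow> 0"
proof (rule LIMSEQ_I)
  fix \<epsilon> :: real
  assume \<epsilon>: "0 < \<epsilon>"
  then obtain N where N: "\<bar>e k\<bar> < \<epsilon> / 2" if "N \<le> k" for k
    using LIMSEQ_D[OF assms, of "\<epsilon> / 2"] by auto
  define A where "A = (\<Sum>k<N. \<bar>e k\<bar>)"
  have le: "\<bar>\<Sum>k<n. e k\<bar> \<le> A + real n * (\<epsilon> / 2)" for n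
  proof -
    have "\<bar>\<Sum>k<n. e k\<bar> \<le> (\<Sum>k<n. \<bar>e k\<bar>)" by (rule sum_abs)
    also have "\<dots> \<le> (\<Sum>k<n. (if k < N then \<bar>e k\<bar> else 0) + \<epsilon> / 2)"
      using N \<epsilon> by (intro sum_mono) (auto simp: not_less less_imp_le)
    also have "\<dots> = (\<Sum>k\<in>{..<n} \<inter> {k. k < N}. \<bar>e k\<bar>) + real n * (\<epsilon> / 2)"
      by (simp add: sum.distrib sum.If_cases)
    also have "(\<Sum>k\<in>{..<n} \<inter> {k. k < N}. \<bar>e k\<bar>) \<le> A"
      unfolding A_def by (intro sum_mono2) auto
    finally show ?thesis by simp
  qed
  obtain n0 :: nat where n0: "A / (\<epsilon> / 2) < real n0" using reals_Archimedean2 by blast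
  show "\<exists>no. \<forall>n\<ge>no. norm ((\<Sum>k<n. e k) / real n - 0) < \<epsilon>"
  proof (intro exI[of _ "Suc n0"] allI impI)
    fix n assume n: "Suc n0 \<le> n"
    have "A / (\<epsilon> / 2) < real n" using n n0 by linarith
    then have "A < real n * (\<epsilon> / 2)" using \<epsilon> by (simp add: field_simps)
    then have "\<bar>\<Sum>k<n. e k\<bar> < real n * \<epsilon>" using le[of n] by simp
    then show "norm ((\<Sum>k<n. e k) / real n - 0) < \<epsilon>"
      using n by (simp add: divide_less_eq mult.commute)
  qed
qed

text \<open>The sequence is a null sequence plus a periodic one. The partial sums of the periodic
  part differ from \<open>n\<close> times its mean by a periodic, hence bounded, quantity
  \<open>s n\<close>.\<close>

lemma cesaro_periodic:
  fixes a :: "nat \<Rightarrow> real"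
  assumes p: "0 < p" and lim: "\<And>i. i < p \<Longrightarrow> (\<lambda>c. a (i + c * p)) \<longlonglongrightarrow> L i"
  shows "(\<lambda>n. (\<Sum>k<n. a k) / real n) \<longlonglongrightarrow> (\<Sum>i<p. L i) / real p"
proof -
  define e where "e k = a k - L (k mod p)" for k
  have "e \<longlonglongrightarrow> 0"
  proof (rule LIMSEQ_I)
    fix \<epsilon> :: real
    assume "0 < \<epsilon>"
    then have "\<forall>i\<in>{..<p}. \<exists>C. \<forall>c\<ge>C. \<bar>a (i + c * p) - L i\<bar> < \<epsilon>"
      using LIMSEQ_D[OF lim, of _ \<epsilon>] by auto
    from bchoice[OF this] obtain C where C: "\<And>i c. i < p \<Longrightarrow> C i \<le> c \<Longrightarrow> \<bar>a (i + c * p) - L i\<bar> < \<epsilon>"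
      by auto
    show "\<exists>no. \<forall>k\<ge>no. norm (e k - 0) < \<epsilon>"
    \<comment> \<open>The sum of the thresholds \<open>C i\<close> exceeds each of them, and the
      factor \<open>p\<close> converts a bound on \<open>k\<close> into one on
      \<open>k div p\<close>.\<close>
    proof (intro exI[of _ "(\<Sum>i<p. C i) * p"] allI impI)
      fix k assume k: "(\<Sum>i<p. C i) * p \<le> k"
      have "(\<Sum>i<p. C i) \<le> k div p"
        using k p by (simp add: less_eq_div_iff_mult_less_eq)
      moreover have "C (k mod p) \<le> (\<Sum>i<p. C i)"
        using p by (intro member_le_sum) auto
      ultimately have "\<bar>a (k mod p + k div p * p) - L (k mod p)\<bar> < \<epsilon>"
        using p by (intro C) auto
      then show "norm (e k - 0) < \<epsilon>"
        by (simp add: e_def)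
    qed
  qed
  then have null: "(\<lambda>n. (\<Sum>k<n. e k) / real n) \<longlonglongrightarrow> 0" by (rule cesaro_null)
  define A where "A = (\<Sum>i<p. L i) / real p"
  define s where "s n = (\<Sum>k<n. L (k mod p)) - real n * A" for n
  have shift: "(\<Sum>k<p + n. L (k mod p)) = (\<Sum>i<p. L i) + (\<Sum>k<n. L (k mod p))" for n
    by (induction n) simp_all
  have s_shift: "s (p + n) = s n" for n
    unfolding s_def shift A_def using p by (simp add: field_simps)
  have "s (j + c * p) = s j" for j c
  proof (induction c)
    case (Suc c)
    then show ?case using s_shift[of "j + c * p"] by (simp add: ac_simps)
  qed simp
  then have s_mod: "s n = s (n mod p)" for n
    by (metis mod_div_mult_eq)
  have "\<bar>s n\<bar> \<le> (\<Sum>i<p. \<bar>s i\<bar>)" for n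
    unfolding s_mod[of n] using p by (intro member_le_sum[where f = "\<lambda>i. \<bar>s i\<bar>"]) auto
  then have bounded: "(\<lambda>n. s n / real n) \<longlonglongrightarrow> 0"
    by (intro Lim_null_comparison[OF _ lim_const_over_n[of "\<Sum>i<p. \<bar>s i\<bar>"]] always_eventually allI)
      (simp add: divide_right_mono)
  have "(\<lambda>n. (\<Sum>k<n. e k) / real n + s n / real n + A) \<longlonglongrightarrow> A"
    using tendsto_add[OF tendsto_add[OF null bounded] tendsto_const[of A]] by simp
  \<comment> \<open>At \<open>n = 0\<close> the quotients are 0 and the left side is
    \<open>A\<close>, so the equality is asserted only from 1 on.\<close>
  moreover have "\<forall>\<^sub>F n in sequentially. (\<Sum>k<n. e k) / real n + s n / real n + A = (\<Sum>k<n. a k) / real n"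
  proof (rule eventually_sequentiallyI[of 1])
    fix n :: nat assume "1 \<le> n"
    then show "(\<Sum>k<n. e k) / real n + s n / real n + A = (\<Sum>k<n. a k) / real n"
      by (simp add: e_def s_def sum_subtractf field_simps)
  qed
  ultimately show ?thesis
    unfolding A_def by (rule Lim_transform_eventually)
qed

section \<open>Probability measures on the unit interval\<close>

lemma sets_unit_lborel: "sets unit_lborel = sets (restrict_space borel {0..<1})"
  by (rule sets_restrict_space_cong) simp

text \<open>Both measures are pushed forward to the line, where finite measures are determined by
  upper half-lines; these are the complements of the given initial segments.\<close>

lemma unit_measure_eqI:
  fixes M N :: "real measure"
  assumes sets: "sets M = sets (restrict_space borel {0..<1})" "sets N = sets (restrict_space borel {0..<1})"
    and prob: "prob_space M" "prob_space N"
    and eq: "\<And>v. measure M ({..v} \<inter> {0..<1}) = measure N ({..v} \<inter> {0..<1})"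
  shows "M = N"
proof -
  interpret M: prob_space M by fact
  interpret N: prob_space N by fact
  have space: "space M = {0..<1}" "space N = {0..<1}"
    using sets_eq_imp_space_eq[OF sets(1)] sets_eq_imp_space_eq[OF sets(2)]
    by (simp_all add: space_restrict_space)
  have id: "(\<lambda>x. x) \<in> measurable M borel" "(\<lambda>x. x) \<in> measurable N borel"
    unfolding measurable_cong_sets[OF sets(1) refl] measurable_cong_sets[OF sets(2) refl]
    by (simp_all add: measurable_restrict_space1)
  have in_sets: "A \<inter> {0..<1} \<in> sets M" "A \<inter> {0..<1} \<in> sets N" if "A \<in> sets borel" for A
    unfolding sets using that by (auto simp: sets_restrict_space)
  have distr: "emeasure (distr M borel (\<lambda>x. x)) A = emeasure M (A \<inter> {0..<1})"
      "emeasure (distr N borel (\<lambda>x. x)) A = emeasure N (A \<inter> {0..<1})" if "A \<in> sets borel" for A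
    using that by (simp_all add: emeasure_distr id space)
  have "measure M ({v<..} \<inter> {0..<1}) = measure N ({v<..} \<inter> {0..<1})" for v
  proof -
    have "{v<..} \<inter> {0..<1} = {0..<1} - {..v} \<inter> {0..<1::real}" by auto
    then show ?thesis
      using M.prob_compl[OF in_sets(1), of "{..v}"] N.prob_compl[OF in_sets(2), of "{..v}"] eq[of v]
      by (simp add: space)
  qed
  then have "distr M borel (\<lambda>x. x) = distr N borel (\<lambda>x. x)"
    by (intro measure_eqI_lessThan) (simp_all add: distr M.emeasure_eq_measure N.emeasure_eq_measure)
  then have eq': "emeasure M (A \<inter> {0..<1}) = emeasure N (A \<inter> {0..<1})" if "A \<in> sets borel" for A
    using distr that by metis
  show ?thesis
  proof (rule measure_eqI)
    show "sets M = sets N" using sets by simp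
    fix A assume "A \<in> sets M"
    then obtain B where "B \<in> sets borel" "A = B \<inter> {0..<1}"
      unfolding sets by (auto simp: sets_restrict_space)
    then show "emeasure M A = emeasure N A" using eq' by simp
  qed
qed

section \<open>Limit densities\<close>

lemma transfer_LIMSEQ:
  assumes "\<And>y. (\<lambda>c. f c y) \<longlonglongrightarrow> g y"
  shows "(\<lambda>c. transfer b (f c) y) \<longlonglongrightarrow> transfer b g y"
  unfolding transfer_def divide_inverse by (intro tendsto_intros assms)

context alternate_base
begin

lemma transfers_LIMSEQ:
  assumes "\<And>y. (\<lambda>c. f c y) \<longlonglongrightarrow> g y"
  shows "(\<lambda>c. transfers m n (f c) y) \<longlonglongrightarrow> transfers m n g y"
proof (induction n arbitrary: y)
  case (Suc n)
  show ?case unfolding transfers.simps by (rule transfer_LIMSEQ[OF Suc])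
qed (simp add: assms)

text \<open>All densities here have integral 1, so the contraction erases whatever happened before
  the last \<open>c\<close> periods. If the earlier history itself consists of whole periods, this
  is the Cauchy property.\<close>

lemma transfers_periods_forget:
  "(\<lambda>c. transfers i (c * period) (transfers m n unit_fun) y - transfers i (c * period) unit_fun y) \<longlonglongrightarrow> 0"
  "Cauchy (\<lambda>c. transfers i (c * period) unit_fun y)"
proof -
  obtain K r where K: "0 \<le> K" and r: "0 < r" "r < 1"
    and contract: "\<And>m n f g y. balanced f \<Longrightarrow> balanced g \<Longrightarrow> (\<integral>x. f x \<partial>lborel) = (\<integral>x. g x \<partial>lborel)
       \<Longrightarrow> \<bar>transfers m n f y - transfers m n g y\<bar> \<le> K * r ^ n * (\<integral>x. f x \<partial>lborel)"
    using transfers_contract by metis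
  have bal: "balanced unit_fun"
    using balanced_transfers_unit_fun[of 0 0] by simp
  have le: "\<bar>transfers i (c * period) (transfers m n unit_fun) y - transfers i (c * period) unit_fun y\<bar>
      \<le> K * r ^ c" for m n c
  proof -
    have "c \<le> c * period"
      using mult_le_mono2[of 1 period c] period_pos by linarith
    then have "r ^ (c * period) \<le> r ^ c" using r by (intro power_decreasing) auto
    then have "K * r ^ (c * period) \<le> K * r ^ c" using K by (rule mult_left_mono)
    then show ?thesis
      using contract[OF balanced_transfers_unit_fun bal, of m n i "c * period" y]
      by (simp add: integral_transfers_unit_fun integral_unit_fun)
  qed
  have null: "(\<lambda>c. K * r ^ c) \<longlonglongrightarrow> 0"
    using LIMSEQ_realpow_zero[of r] r tendsto_mult_right_zero by auto
  show "(\<lambda>c. transfers i (c * period) (transfers m n unit_fun) y - transfers i (c * period) unit_fun y) \<longlonglongrightarrow> 0"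
    by (rule Lim_null_comparison[OF _ null]) (simp add: le)
  show "Cauchy (\<lambda>c. transfers i (c * period) unit_fun y)"
  proof (rule CauchyI')
    fix e :: real
    assume "0 < e"
    then obtain M where M: "\<And>c. M \<le> c \<Longrightarrow> \<bar>K * r ^ c\<bar> < e"
      using LIMSEQ_D[OF null] by auto
    show "\<exists>M. \<forall>m\<ge>M. \<forall>n>m. dist (transfers i (m * period) unit_fun y) (transfers i (n * period) unit_fun y) < e"
    proof (intro exI[of _ M] allI impI)
      fix m n assume mn: "M \<le> m" "m < n"
      have n: "n * period = (n - m) * period + m * period"
        using mn by (simp add: add_mult_distrib[symmetric])
      \<comment> \<open>The surplus periods are performed first and moved into the initial density,
        and by periodicity the later operators still start at index \<open>i\<close>.\<close>
      have "transfers i (n * period) unit_fun = transfers i (m * period) (transfers i ((n - m) * period) unit_fun)"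
        unfolding n transfers_compose transfers_add_period ..
      then show "dist (transfers i (m * period) unit_fun y) (transfers i (n * period) unit_fun y) < e"
        using le[of m i "(n - m) * period"] M[OF mn(1)] by (simp add: dist_real_def abs_minus_commute)
    qed
  qed
qed

definition limit_density :: "int \<Rightarrow> real \<Rightarrow> real" where
  "limit_density i y = lim (\<lambda>c. transfers i (c * period) unit_fun y)"

lemma LIMSEQ_limit_density: "(\<lambda>c. transfers i (c * period) unit_fun y) \<longlonglongrightarrow> limit_density i y"
  unfolding limit_density_def
  using transfers_periods_forget(2) by (simp add: Cauchy_convergent_iff convergent_LIMSEQ_iff)

text \<open>The first \<open>n\<close> steps only change the initial density, which is forgotten;
  what remains is the phase \<open>m + n\<close>.\<close>

lemma LIMSEQ_limit_density_from:
  "(\<lambda>c. transfers m (n + c * period) unit_fun y) \<longlonglongrightarrow> limit_density (m + int n) y"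
proof -
  let ?f = "\<lambda>c. transfers (m + int n) (c * period)"
  have "(\<lambda>c. (?f c (transfers m n unit_fun) y - ?f c unit_fun y) + ?f c unit_fun y) \<longlonglongrightarrow> 0 + limit_density (m + int n) y"
    by (intro tendsto_add transfers_periods_forget LIMSEQ_limit_density)
  then show ?thesis by (simp add: transfers_compose)
qed

lemma transfers_unit_fun_bounds: "0 \<le> transfers m n unit_fun y" "transfers m n unit_fun y \<le> cone_const / 2"
  using decreasing_le_0[OF decreasing_transfers[OF decreasing_unit_fun], of m n y] transfers_unit_fun_0_le[of m n]
    decreasing_nonneg[OF decreasing_transfers[OF decreasing_unit_fun], of m n y] by linarith+

lemma limit_density_nonneg: "0 \<le> limit_density i y"
  by (rule LIMSEQ_le_const[OF LIMSEQ_limit_density]) (simp add: transfers_unit_fun_bounds)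

lemma regular_limit_density: "regular (limit_density i)"
proof (rule regularI[where B = "cone_const / 2"])
  show "limit_density i \<in> borel_measurable borel"
    by (rule borel_measurable_LIMSEQ_real[OF LIMSEQ_limit_density])
      (rule regular_measurable[OF regular_transfers[OF regular_unit_fun]])
  show "\<bar>limit_density i y\<bar> \<le> cone_const / 2" for y
  proof -
    have "limit_density i y \<le> cone_const / 2"
      by (rule LIMSEQ_le_const2[OF LIMSEQ_limit_density]) (intro exI allI impI transfers_unit_fun_bounds)
    then show ?thesis using limit_density_nonneg[of i y] by simp
  qed
  show "limit_density i y = 0" if "y \<notin> {0..<1}" for y
    using LIMSEQ_limit_density[of i y] regular_outside[OF regular_transfers[OF regular_unit_fun] that]
    by (simp add: LIMSEQ_const_iff)
qed

lemma LIMSEQ_integral_limit_density: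
  assumes [measurable]: "E \<in> sets borel"
  shows "(\<lambda>c. \<integral>y. indicator E y * transfers m (n + c * period) unit_fun y \<partial>lborel)
    \<longlonglongrightarrow> (\<integral>y. indicator E y * limit_density (m + int n) y \<partial>lborel)"
proof (rule integral_dominated_convergence[where w = "\<lambda>y. cone_const / 2 * indicator {0..<1} y"])
  show "(\<lambda>y. indicator E y * limit_density (m + int n) y) \<in> borel_measurable lborel"
    using regular_measurable[OF regular_limit_density] by simp
  show "(\<lambda>y. indicator E y * transfers m (n + c * period) unit_fun y) \<in> borel_measurable lborel" for c
    using regular_measurable[OF regular_transfers[OF regular_unit_fun]] by simp
  show "AE y in lborel. (\<lambda>c. indicator E y * transfers m (n + c * period) unit_fun y)
      \<longlonglongrightarrow> indicator E y * limit_density (m + int n) y"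
    by (intro AE_I2 tendsto_mult_left LIMSEQ_limit_density_from)
  show "AE y in lborel. norm (indicator E y * transfers m (n + c * period) unit_fun y)
      \<le> cone_const / 2 * indicator {0..<1} y" for c
  proof (rule AE_I2)
    fix y :: real
    show "norm (indicator E y * transfers m (n + c * period) unit_fun y) \<le> cone_const / 2 * indicator {0..<1} y"
      using regular_outside[OF regular_transfers[OF regular_unit_fun], of y m "n + c * period"] cone_const_gt_4
        transfers_unit_fun_bounds[of m "n + c * period" y]
      by (auto simp: indicator_def)
  qed
qed simp

lemma integral_limit_density: "(\<integral>y. limit_density i y \<partial>lborel) = 1"
  using LIMSEQ_integral_limit_density[of UNIV i 0] by (simp add: integral_transfers_unit_fun LIMSEQ_const_iff)

text \<open>One more period merely shifts the approximating sequence from \<open>c\<close> to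
  \<open>c + 1\<close>.\<close>

lemma transfers_period_limit_density: "transfers i period (limit_density i) = limit_density i"
proof
  fix y
  have "(\<lambda>c. transfers i period (transfers i (c * period) unit_fun) y) \<longlonglongrightarrow> transfers i period (limit_density i) y"
    by (rule transfers_LIMSEQ[OF LIMSEQ_limit_density])
  moreover have "transfers i period (transfers i (c * period) unit_fun) = transfers i (Suc c * period) unit_fun" for c
    by (simp only: mult_Suc add.commute[of period] transfers_compose transfers_add_period)
  ultimately show "transfers i period (limit_density i) y = limit_density i y"
    using LIMSEQ_unique LIMSEQ_Suc[OF LIMSEQ_limit_density] by simp blast
qed

lemma LIMSEQ_visit_prob:
  assumes "E \<in> sets borel" "\<And>c. D (n + c * period) = E"
  shows "(\<lambda>c. visit_prob m D (n + c * period)) \<longlonglongrightarrow> (\<integral>y. indicator E y * limit_density (m + int n) y \<partial>lborel)"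
  unfolding visit_prob_def assms(2) by (rule LIMSEQ_integral_limit_density[OF assms(1)])

section \<open>Existence and uniqueness of the invariant measures\<close>

definition limit_measure :: "int \<Rightarrow> real measure" where
  "limit_measure i = density unit_lborel (\<lambda>x. ennreal (limit_density i x))"

lemma sets_limit_measure: "sets (limit_measure i) = sets (restrict_space borel {0..<1})"
  unfolding limit_measure_def by (simp add: sets_unit_lborel)

lemma space_limit_measure: "space (limit_measure i) = {0..<1}"
  unfolding limit_measure_def by (simp add: space_restrict_space)

lemma emeasure_limit_measure:
  assumes "A \<in> sets borel"
  shows "emeasure (limit_measure i) (A \<inter> {0..<1}) = ennreal (\<integral>x. indicator A x * limit_density i x \<partial>lborel)"
proof -
  note [measurable] = assms regular_measurable[OF regular_limit_density]
  have m: "limit_density i \<in> borel_measurable unit_lborel"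
    by (intro measurable_restrict_space1) measurable
  have A: "A \<inter> {0..<1} \<in> sets unit_lborel"
    using assms by (auto simp: sets_restrict_space)
  have "emeasure (limit_measure i) (A \<inter> {0..<1})
      = (\<integral>\<^sup>+x. ennreal (limit_density i x) * indicator (A \<inter> {0..<1}) x \<partial>unit_lborel)"
    unfolding limit_measure_def using m A by (intro emeasure_density) auto
  also have "\<dots> = (\<integral>\<^sup>+x. ennreal (limit_density i x) * indicator (A \<inter> {0..<1}) x * indicator {0..<1} x \<partial>lborel)"
    by (rule nn_integral_restrict_space) simp
  also have "\<dots> = (\<integral>\<^sup>+x. ennreal (indicator A x * limit_density i x) \<partial>lborel)"
    using regular_outside[OF regular_limit_density[of i]]
    by (intro nn_integral_cong) (auto simp: indicator_def)
  also have "\<dots> = ennreal (\<integral>x. indicator A x * limit_density i x \<partial>lborel)"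
    by (intro nn_integral_eq_integral regular_integrable regular_cut regular_limit_density assms AE_I2)
      (simp add: limit_density_nonneg)
  finally show ?thesis .
qed

lemma measure_limit_measure:
  assumes "A \<in> sets borel"
  shows "measure (limit_measure i) (A \<inter> {0..<1}) = (\<integral>x. indicator A x * limit_density i x \<partial>lborel)"
  unfolding measure_def emeasure_limit_measure[OF assms]
  by (simp add: limit_density_nonneg)

lemma beta_comp_measurable_unit:
  assumes "sets M = sets (restrict_space borel {0..<1})"
  shows "beta_comp \<beta> m n \<in> measurable M M"
proof -
  have "beta_comp \<beta> m n \<in> measurable (restrict_space borel {0..<1}) (restrict_space borel {0..<1})"
    by (rule measurable_restrict_space3[OF beta_comp_measurable]) (use beta_comp_in_unit in auto)
  then show ?thesis
    unfolding measurable_cong_sets[OF assms assms] .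
qed

text \<open>Invariance is the dual form of the fixed-point equation
  \<open>transfers_period_limit_density\<close>.\<close>

lemma is_acip_limit_measure: "is_acip (limit_measure i) (beta_comp \<beta> i period)"
  unfolding is_acip_def invariant_measure_def
proof (intro conjI ballI)
  show "sets (limit_measure i) = sets (restrict_space borel {0..<1})" by (rule sets_limit_measure)
  show "prob_space (limit_measure i)"
    using emeasure_limit_measure[of UNIV i]
    by (intro prob_spaceI) (simp add: space_limit_measure integral_limit_density)
  show "absolutely_continuous unit_lborel (limit_measure i)"
    unfolding limit_measure_def
    using regular_measurable[OF regular_limit_density[of i]]
    by (intro absolutely_continuousI_density) (simp add: measurable_restrict_space1)
  show "beta_comp \<beta> i period \<in> measurable (limit_measure i) (limit_measure i)"
    by (rule beta_comp_measurable_unit[OF sets_limit_measure])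
  fix A assume "A \<in> sets (limit_measure i)"
  then obtain B where [measurable]: "B \<in> sets borel" and A: "A = B \<inter> {0..<1}"
    unfolding sets_limit_measure by (auto simp: sets_restrict_space)
  let ?T = "beta_comp \<beta> i period"
  have vimage: "?T -` A \<inter> space (limit_measure i) = (?T -` B) \<inter> {0..<1}"
    using beta_comp_in_unit by (auto simp: A space_limit_measure)
  have "?T -` B \<in> sets borel"
    using measurable_sets[OF beta_comp_measurable, of B] by simp
  then have "emeasure (limit_measure i) (?T -` A \<inter> space (limit_measure i))
      = ennreal (\<integral>x. indicator B (?T x) * limit_density i x \<partial>lborel)"
    unfolding vimage by (simp add: emeasure_limit_measure indicator_vimage)
  also have "(\<integral>x. indicator B (?T x) * limit_density i x \<partial>lborel) = (\<integral>y. indicator B y * transfers i period (limit_density i) y \<partial>lborel)"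
    by (rule integral_transfers_mult[where B = 1, OF regular_limit_density]) (auto simp: indicator_def)
  also have "ennreal \<dots> = emeasure (limit_measure i) A"
    by (simp add: transfers_period_limit_density A emeasure_limit_measure)
  finally show "emeasure (limit_measure i) (?T -` A \<inter> space (limit_measure i)) = emeasure (limit_measure i) A" .
qed

text \<open>After one period the index has advanced by the period, so the next maps are the same as
  before and the composition over \<open>c\<close> periods is a genuine iterate.\<close>

lemma invariant_iterate:
  assumes "is_acip \<nu> (beta_comp \<beta> i period)" "A \<in> sets \<nu>"
  shows "emeasure \<nu> (beta_comp \<beta> i (c * period) -` A \<inter> space \<nu>) = emeasure \<nu> A"
proof (induction c)
  case 0
  then show ?case using sets.sets_into_space[OF assms(2)] by (simp add: Int_absorb2)
next
  case (Suc c)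
  let ?T = "beta_comp \<beta> i period"
  have inv: "?T \<in> measurable \<nu> \<nu>" "\<And>A. A \<in> sets \<nu> \<Longrightarrow> emeasure \<nu> (?T -` A \<inter> space \<nu>) = emeasure \<nu> A"
    and sets: "sets \<nu> = sets (restrict_space borel {0..<1})"
    using assms(1) by (auto simp: is_acip_def invariant_measure_def)
  let ?B = "beta_comp \<beta> i (c * period) -` A \<inter> space \<nu>"
  have "?B \<in> sets \<nu>"
    by (rule measurable_sets[OF beta_comp_measurable_unit[OF sets] assms(2)])
  have "beta_comp \<beta> i (Suc c * period) x = beta_comp \<beta> i (c * period) (?T x)" for x
    using beta_comp_add[of i period "c * period" x] beta_comp_add_period[of i 1] by simp
  then have "beta_comp \<beta> i (Suc c * period) -` A \<inter> space \<nu> = ?T -` ?B \<inter> space \<nu>"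
    using measurable_space[OF inv(1)] by auto
  then show ?case using inv(2)[OF \<open>?B \<in> sets \<nu>\<close>] Suc by simp
qed

text \<open>The strong law holds Lebesgue-almost everywhere, hence almost everywhere with respect to any
  absolutely continuous measure. Integrating it against an invariant one identifies that measure.\<close>

lemma acip_unique:
  assumes \<nu>: "is_acip \<nu> (beta_comp \<beta> i period)"
  shows "\<nu> = limit_measure i"
proof (rule unit_measure_eqI)
  show sets: "sets \<nu> = sets (restrict_space borel {0..<1})" and "prob_space \<nu>"
    using \<nu> by (auto simp: is_acip_def)
  interpret prob_space \<nu> by fact
  show "sets (limit_measure i) = sets (restrict_space borel {0..<1})" "prob_space (limit_measure i)"
    using is_acip_limit_measure[of i] by (auto simp: is_acip_def)
  have space: "space \<nu> = {0..<1}"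
    using sets_eq_imp_space_eq[OF sets] by (simp add: space_restrict_space)
  fix v :: real
  \<comment> \<open>Visits are counted only at multiples of the period, the times at which
    invariance of the measure gives information.\<close>
  define D where "D k = (if k mod period = 0 then {..v} else {})" for k
  have D: "down_set (D k)" for k
    by (simp add: D_def down_set_atMost down_set_empty)
  note [measurable] = down_set_measurable[OF D]
  let ?X = "\<lambda>k x. indicator (D k) (beta_comp \<beta> i k x) :: real"
  let ?p = "visit_prob i D"
  define q where "q k = (\<integral>x. ?X k x \<partial>\<nu>)" for k
  have mX: "?X k \<in> borel_measurable \<nu>" for k
    unfolding measurable_cong_sets[OF sets refl] by (intro measurable_restrict_space1) measurable
  have intX: "integrable \<nu> (?X k)" for k
    by (rule integrable_const_bound[where B = 1, OF _ mX]) (simp add: indicator_def)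
  have "AE x in \<nu>. (\<lambda>n. (\<Sum>k<n. ?X k x - ?p k) / real n) \<longlonglongrightarrow> 0"
  proof (rule absolutely_continuous_AE[OF _ _ strong_law[OF D]])
    show "sets \<nu> = sets unit_lborel" by (simp add: sets sets_unit_lborel)
    show "absolutely_continuous unit_lborel \<nu>" using \<nu> by (simp add: is_acip_def)
  qed
  then have lim: "(\<lambda>n. \<integral>x. (\<Sum>k<n. ?X k x - ?p k) / real n \<partial>\<nu>) \<longlonglongrightarrow> (\<integral>x. 0 \<partial>\<nu>)"
  proof (intro integral_dominated_convergence[where w = "\<lambda>_. 1"])
    show "(\<lambda>x. (\<Sum>k<n. ?X k x - ?p k) / real n) \<in> borel_measurable \<nu>" for n
      using mX by simp
    show "AE x in \<nu>. norm ((\<Sum>k<n. ?X k x - ?p k) / real n) \<le> 1" for n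
    proof (rule AE_I2)
      fix x
      have "\<bar>?X k x - ?p k\<bar> \<le> 1" for k
        using visit_prob_bounds[of D k i] by (auto simp: indicator_def)
      then have "\<bar>\<Sum>k<n. ?X k x - ?p k\<bar> \<le> (\<Sum>k<n. 1)"
        by (intro order_trans[OF sum_abs] sum_mono)
      then show "norm ((\<Sum>k<n. ?X k x - ?p k) / real n) \<le> 1"
        by (simp add: divide_le_eq)
    qed
  qed auto
  have mean: "(\<integral>x. (\<Sum>k<n. ?X k x - ?p k) / real n \<partial>\<nu>) = (\<Sum>k<n. q k - ?p k) / real n" for n
    by (simp add: q_def intX prob_space)
  have null: "(\<lambda>n. (\<Sum>k<n. q k - ?p k) / real n) \<longlonglongrightarrow> 0"
    using lim unfolding mean by simp
  \<comment> \<open>In the residue class of 0 the first term is constant by invariance and the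
    second converges to the limit measure; in the other classes the target set is empty.\<close>
  define l where "l j = (if j = 0 then measure \<nu> ({..v} \<inter> {0..<1}) - measure (limit_measure i) ({..v} \<inter> {0..<1}) else 0)" for j :: nat
  have "(\<lambda>c. q (j + c * period) - ?p (j + c * period)) \<longlonglongrightarrow> l j" if "j < period" for j
  proof (cases "j = 0")
    case True
    have "q (c * period) = measure \<nu> ({..v} \<inter> {0..<1})" for c
    proof -
      have A: "{..v} \<inter> {0..<1} \<in> sets \<nu>" unfolding sets by (auto simp: sets_restrict_space)
      have "q (c * period) = (\<integral>x. indicator (beta_comp \<beta> i (c * period) -` ({..v} \<inter> {0..<1}) \<inter> space \<nu>) x \<partial>\<nu>)"
        unfolding q_def D_def using beta_comp_in_unit
        by (intro Bochner_Integration.integral_cong) (auto simp: indicator_def space)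
      also have "\<dots> = measure \<nu> (beta_comp \<beta> i (c * period) -` ({..v} \<inter> {0..<1}) \<inter> space \<nu>)"
        by simp
      finally show ?thesis
        using invariant_iterate[OF \<nu> A, of c] by (simp add: measure_def)
    qed
    moreover have "(\<lambda>c. ?p (0 + c * period)) \<longlonglongrightarrow> (\<integral>y. indicator {..v} y * limit_density (i + int 0) y \<partial>lborel)"
      by (rule LIMSEQ_visit_prob) (simp_all add: D_def)
    ultimately show ?thesis
      using True by (simp add: l_def measure_limit_measure tendsto_diff)
  next
    case False
    then have "D (j + c * period) = {}" for c using that by (simp add: D_def)
    then show ?thesis using False by (simp add: q_def visit_prob_def l_def)
  qed
  \<comment> \<open>The same averages tend to 0 by the integrated strong law and to
    \<open>l 0 / period\<close> by periodicity, so \<open>l 0 = 0\<close>.\<close>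
  from cesaro_periodic[OF period_pos this]
  have "(\<lambda>n. (\<Sum>k<n. q k - ?p k) / real n) \<longlonglongrightarrow> (\<Sum>j<period. l j) / real period" .
  then have "(\<Sum>j<period. l j) = 0"
    using LIMSEQ_unique[OF null] period_pos by fastforce
  moreover have "(\<Sum>j<period. l j) = l 0"
    using period_pos by (subst sum.remove[of _ 0]) (auto simp: l_def)
  ultimately show "measure \<nu> ({..v} \<inter> {0..<1}) = measure (limit_measure i) ({..v} \<inter> {0..<1})"
    by (simp add: l_def)
qed

text \<open>The definition starts the composition at index \<open>i - period\<close>, which by
  periodicity is the composition starting at \<open>i\<close>.\<close>

lemma beta_measure_eq: "beta_measure \<beta> i = limit_measure i"
proof -
  have "beta_comp \<beta> (i - int period) period = beta_comp \<beta> i period"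
    using beta_comp_add_period[of "i - int period" 1 period] by simp
  then show ?thesis
    unfolding beta_measure_def using is_acip_limit_measure acip_unique by (intro the_equality) auto
qed

section \<open>Digit frequencies\<close>

text \<open>A digit interval is not an initial segment, but it is the difference of two, to each of
  which \<open>strong_law\<close> applies.\<close>

lemma frequency_indicator:
  assumes "x \<in> {0..<1}"
  shows "(if greedy_digit \<beta> x k = d then 1 else 0)
    = indicator {..<(real d + 1) / base (int k)} (beta_comp \<beta> 0 k x) - (indicator {..<real d / base (int k)} (beta_comp \<beta> 0 k x) :: real)"
proof -
  let ?b = "base (int k)" and ?y = "beta_comp \<beta> 0 k x"
  have b: "1 < ?b" by (rule base_gt_1)
  have y: "0 \<le> ?b * ?y" using beta_comp_in_unit[OF assms, of 0 k] b by simp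
  have "greedy_digit \<beta> x k = d \<longleftrightarrow> \<lfloor>?b * ?y\<rfloor> = int d"
    using y by (simp add: greedy_digit_def nat_eq_iff)
  also have "\<dots> \<longleftrightarrow> real d / ?b \<le> ?y \<and> ?y < (real d + 1) / ?b"
    using b by (simp add: floor_eq_iff field_simps)
  finally have eq: "greedy_digit \<beta> x k = d \<longleftrightarrow> real d / ?b \<le> ?y \<and> ?y < (real d + 1) / ?b" .
  have "real d / ?b \<le> (real d + 1) / ?b"
    using b by (simp add: divide_right_mono)
  then show ?thesis
    unfolding eq by (auto simp: indicator_def)
qed

text \<open>The strong law reduces the frequency to the average visit probability of the digit
  intervals. Along each residue class \<open>i\<close> modulo the period this probability converges
  to the measure of the interval, so the average converges to the mean over all
  \<open>i\<close>.\<close>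

theorem AE_has_frequency:
  "AE x in unit_lborel. has_frequency (greedy_digit \<beta> x) d
     (1 / real period * (\<Sum>i<period. measure (beta_measure \<beta> (int i))
        ({real d / base (int i)..<(real d + 1) / base (int i)} \<inter> {0..<1})))"
proof -
  define U where "U k = {..<(real d + 1) / base (int k)}" for k
  define V where "V k = {..<real d / base (int k)}" for k
  have U: "down_set (U k)" and V: "down_set (V k)" for k
    by (simp_all add: U_def V_def down_set_lessThan)
  let ?\<mu> = "\<lambda>i. measure (beta_measure \<beta> (int i)) ({real d / base (int i)..<(real d + 1) / base (int i)} \<inter> {0..<1})"
  have \<mu>: "?\<mu> i = (\<integral>y. indicator (U i) y * limit_density (int i) y \<partial>lborel)
      - (\<integral>y. indicator (V i) y * limit_density (int i) y \<partial>lborel)" for i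
  proof -
    have sub: "real d / base (int i) \<le> (real d + 1) / base (int i)"
      using base_gt_1[of "int i"] by (simp add: divide_right_mono)
    have "?\<mu> i = (\<integral>y. indicator {real d / base (int i)..<(real d + 1) / base (int i)} y * limit_density (int i) y \<partial>lborel)"
      unfolding beta_measure_eq by (rule measure_limit_measure) simp
    also have "\<dots> = (\<integral>y. indicator (U i) y * limit_density (int i) y - 1 * (indicator (V i) y * limit_density (int i) y) \<partial>lborel)"
      using sub by (intro Bochner_Integration.integral_cong) (auto simp: U_def V_def indicator_def)
    also have "\<dots> = (\<integral>y. indicator (U i) y * limit_density (int i) y \<partial>lborel)
        - 1 * (\<integral>y. indicator (V i) y * limit_density (int i) y \<partial>lborel)"
      by (intro integral_regular_minus regular_cut regular_limit_density down_set_measurable U V)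
    finally show ?thesis by simp
  qed
  have per: "base (int (i + c * period)) = base (int i)" for i c
    using base_add_period[of "int i" c] by simp
  have per: "U (i + c * period) = U i" "V (i + c * period) = V i" for i c
    by (simp_all only: U_def V_def per)
  have "(\<lambda>c. visit_prob 0 U (i + c * period) - visit_prob 0 V (i + c * period)) \<longlonglongrightarrow> ?\<mu> i" for i
    unfolding \<mu>
    using LIMSEQ_visit_prob[OF down_set_measurable[OF U[of i]], of U i 0, OF per(1)]
      LIMSEQ_visit_prob[OF down_set_measurable[OF V[of i]], of V i 0, OF per(2)]
    by (intro tendsto_diff) simp_all
  then have mean: "(\<lambda>n. (\<Sum>k<n. visit_prob 0 U k - visit_prob 0 V k) / real n) \<longlonglongrightarrow> (\<Sum>i<period. ?\<mu> i) / real period"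
    by (intro cesaro_periodic period_pos)
  have "AE x in unit_lborel. x \<in> {0..<1}"
    by (rule AE_I2) (simp add: space_restrict_space)
  with strong_law[where m = 0 and D = U, OF U] strong_law[where m = 0 and D = V, OF V] show ?thesis
  proof eventually_elim
    case (elim x)
    have card: "real (card {k. k < n \<and> greedy_digit \<beta> x k = d})
        = (\<Sum>k<n. indicator (U k) (beta_comp \<beta> 0 k x) - indicator (V k) (beta_comp \<beta> 0 k x))" for n
    proof -
      have "real (card {k. k < n \<and> greedy_digit \<beta> x k = d}) = (\<Sum>k<n. if greedy_digit \<beta> x k = d then 1 else 0)"
        by (simp add: sum.If_cases Int_def)
      then show ?thesis
        by (simp only: frequency_indicator[OF elim(3)] U_def V_def)
    qed
    \<comment> \<open>The digit count divided by \<open>n\<close> is the sum of the two centred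
      averages, which vanish in the limit, and the average of the means.\<close>
    have "(\<lambda>n. (\<Sum>k<n. indicator (U k) (beta_comp \<beta> 0 k x) - visit_prob 0 U k) / real n
        - (\<Sum>k<n. indicator (V k) (beta_comp \<beta> 0 k x) - visit_prob 0 V k) / real n
        + (\<Sum>k<n. visit_prob 0 U k - visit_prob 0 V k) / real n) \<longlonglongrightarrow> 0 - 0 + (\<Sum>i<period. ?\<mu> i) / real period"
      by (intro tendsto_add tendsto_diff elim(1,2) mean)
    then have "(\<lambda>n. real (card {k. k < n \<and> greedy_digit \<beta> x k = d}) / real n) \<longlonglongrightarrow> (\<Sum>i<period. ?\<mu> i) / real period"
      by (simp add: card sum_subtractf add_divide_distrib[symmetric] diff_divide_distrib[symmetric])
    then show ?case by (simp add: has_frequency_def)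
  qed
qed

end

theorem proposition29:
  fixes p :: nat and \<beta> :: "real list"
  assumes "p \<ge> 1" and "length \<beta> = p" and "\<And>b. b \<in> set \<beta> \<Longrightarrow> b > 1"
  shows "AE x in unit_lborel. \<forall>d \<in> range (greedy_digit \<beta> x).
           has_frequency (greedy_digit \<beta> x) d
             (1 / real p * (\<Sum>i<p. measure (beta_measure \<beta> (int i))
                ({real d / beta_at \<beta> (int i)..<(real d + 1) / beta_at \<beta> (int i)} \<inter> {0..<1})))"
proof -
  interpret alternate_base \<beta>
    by unfold_locales (use assms in auto)
  \<comment> \<open>Digits are natural numbers, so the exceptional null sets of the single digits
    combine into one.\<close>
  have "AE x in unit_lborel. \<forall>d. has_frequency (greedy_digit \<beta> x) d
             (1 / real p * (\<Sum>i<p. measure (beta_measure \<beta> (int i))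
                ({real d / beta_at \<beta> (int i)..<(real d + 1) / beta_at \<beta> (int i)} \<inter> {0..<1})))"
    using AE_has_frequency unfolding AE_all_countable assms(2) by blast
  then show ?thesis by (rule eventually_mono) blast
qed

end
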